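(* Let $E$ be an energy form on $L^0(m)$ and let $\widetilde E$ be a transient Silverstein extension of $E$. Let $h$ be a strictly positive $\widetilde E$-superharmonic function. The following assertions are equivalent. (i) There exists a special $E$-nest $\mathcal N$ such that $\inf_{N\in\mathcal N}{\rm cap}_{\widetilde E,h}(X\setminus N)=0$. (ii) For all $E$-nests $\mathcal N$ we have $\inf_{N\in\mathcal N}{\rm cap}_{\widetilde E,h}(X\setminus N)=0$. (iii) $E=\widetilde E$.
   Context: $(X,\mathcal B,m)$ is a measure space with $m$ localizable: $m$ is semi-finite and every family $\mathcal A\subseteq\mathcal B$ has an essential supremum $S\in\mathcal B$, i.e. $m(A\setminus S)=0$ for all $A\in\mathcal A$, and $m(S\setminus G)=0$ whenever $G\in\mathcal B$ satisfies $m(A\setminus G)=0$ for all $A\in\mathcal A$. $L^0(m)$ is the space of real-valued measurable functions modulo $m$-a.e. equality, with the topology $\tau(m)$ of local convergence in measure: $f_i\to f$ iff $\int_U|f_i-f|\wedge1\,dm\to0$ for every measurable $U$ with $m(U)<\infty$. A quadratic form on $L^0(m)$ is a map $q:L^0(m)\to[0,\infty]$ with $2q(u)+2q(v)=q(u+v)+q(u-v)$ and $q(\lambda u)=|\lambda|^2q(u)$ ($0\cdot\infty=0$); $D(q)=\{q<\infty\}$, $\ker q=\{q=0\}$, and $q(u,v)=\frac14(q(u+v)-q(u-v))$ is the induced bilinear form on $D(q)$. The form topology on $D(q)$ is the smallest topology containing the subspace topology of $\tau(m)$ and the topology of the seminorm $q^{1/2}$; $q$ is closed if $D(q)$ is complete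 in it. $\tilde q$ is an extension of $q$ if $D(q)\subseteq D(\tilde q)$ and $\tilde q=q$ on $D(q)$. An $\varepsilon$-cutoff is a monotone increasing map $C:\mathbb R\to[-\varepsilon,1+\varepsilon]$ with $|C(x)-C(y)|\le|x-y|$ and $C(x)=x$ for $x\in[0,1]$. A quadratic form $E$ on $L^0(m)$ is Markovian if for each $\varepsilon>0$ there is an $\varepsilon$-cutoff $C_\varepsilon$ with $E(C_\varepsilon\circ f)\le E(f)$ for all $f\in L^0(m)$; an energy form is a closed Markovian form on $L^0(m)$. It is transient if its kernel is $\{0\}$. A Silverstein extension of an energy form $E$ is an energy form $\widetilde E$ extending $E$ such that $fg\in D(E)$ for all $f\in D(E)\cap L^\infty(m)$, $g\in D(\widetilde E)\cap L^\infty(m)$ (equivalently, $f\in D(E)$, $g\in D(\widetilde E)$, $|g|\le|f|$ imply $g\in D(E)$). $h\in D(\widetilde E)$ is $\widetilde E$-superharmonic if $\widetilde E(h,\psi)\ge0$ for all nonnegative $\psi\in D(\widetilde E)$; strictly positive means $h>0$ $m$-a.e. For measurable $U$, ${\rm cap}_{\widetilde E,h}(U)=\inf\{\widetilde E(f): f\in L^0(m),\ f1_U\ge h1_U\}$. An $E$-nest is a collection $\mathcal N$ of measurable sets such that $D(E)_{\mathcal N}=\{f\in D(E): \exists N\in\mathcal N,\ f1_{X\setminus N}=0\}$ is a dense subspace of $D(E)$ with respect to the form topology of $E$. It is special if for each $N\in\mathcal N$ there is $g_N\in D(E)_{\mathcal N}$ with $g_N\ge1_N$. *)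

theory Defs
  imports "HOL-Analysis.Analysis"
begin

text \<open>
  An element of $L^0(m)$ is represented by a function in \<^term>\<open>borel_measurable M\<close>.  Instead of
  passing to classes modulo almost everywhere equality, (in)equalities between elements of
  $L^0(m)$ are almost everywhere statements, and quadratic forms are required to respect almost
  everywhere equality.  The topologies below live on representatives: they are the pullbacks of the
  topologies on classes, hence not Hausdorff, but density and completeness mean the same.
\<close>

abbreviation L0 :: "'a measure \<Rightarrow> ('a \<Rightarrow> real) set" where
  "L0 M \<equiv> borel_measurable M"

definition Linfty :: "'a measure \<Rightarrow> ('a \<Rightarrow> real) set" where
  "Linfty M = {f \<in> L0 M. \<exists>c. AE x in M. \<bar>f x\<bar> \<le> c}"


section \<open>Localizable measures\<close>

definition semi_finite :: "'a measure \<Rightarrow> bool" where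
  "semi_finite M \<longleftrightarrow>
     (\<forall>A\<in>sets M. emeasure M A = \<infinity> \<longrightarrow>
        (\<exists>B\<in>sets M. B \<subseteq> A \<and> 0 < emeasure M B \<and> emeasure M B < \<infinity>))"

definition is_ess_sup :: "'a measure \<Rightarrow> 'a set set \<Rightarrow> 'a set \<Rightarrow> bool" where
  "is_ess_sup M \<A> S \<longleftrightarrow> S \<in> sets M
     \<and> (\<forall>A\<in>\<A>. emeasure M (A - S) = 0)
     \<and> (\<forall>G\<in>sets M. (\<forall>A\<in>\<A>. emeasure M (A - G) = 0) \<longrightarrow> emeasure M (S - G) = 0)"

definition localizable :: "'a measure \<Rightarrow> bool" where
  "localizable M \<longleftrightarrow> semi_finite M \<and> (\<forall>\<A>\<subseteq>sets M. \<exists>S. is_ess_sup M \<A> S)"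


section \<open>Local convergence in measure\<close>

definition meas_dist :: "'a measure \<Rightarrow> 'a set \<Rightarrow> ('a \<Rightarrow> real) \<Rightarrow> ('a \<Rightarrow> real) \<Rightarrow> ennreal" where
  "meas_dist M U f g = (\<integral>\<^sup>+x\<in>U. ennreal (min \<bar>f x - g x\<bar> 1) \<partial>M)"

definition tau :: "'a measure \<Rightarrow> ('a \<Rightarrow> real) topology" where
  "tau M = topology_generated_by
     {{g \<in> L0 M. meas_dist M U f g < ennreal r} | U f r.
        U \<in> sets M \<and> emeasure M U < \<infinity> \<and> f \<in> L0 M \<and> 0 < r}"

lemma topspace_tau: "topspace (tau M) = L0 M"
proof -
  have "g \<in> topspace (tau M)" if g: "g \<in> L0 M" for g
  proof -
    have "g \<in> {h \<in> L0 M. meas_dist M {} g h < ennreal 1}"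
      using g by (simp add: meas_dist_def)
    moreover have "{h \<in> L0 M. meas_dist M {} g h < ennreal 1} \<in>
        {{h \<in> L0 M. meas_dist M U f h < ennreal r} | U f r.
          U \<in> sets M \<and> emeasure M U < \<infinity> \<and> f \<in> L0 M \<and> 0 < r}"
      using g by (intro CollectI exI[of _ "{}"] exI[of _ g] exI[of _ 1]) auto
    ultimately show ?thesis
      unfolding tau_def topology_generated_by_topspace by blast
  qed
  moreover have "topspace (tau M) \<subseteq> L0 M"
    unfolding tau_def topology_generated_by_topspace by blast
  ultimately show ?thesis by blast
qed

lemma meas_dist_triangle:
  assumes "U \<in> sets M" "f \<in> L0 M" "g \<in> L0 M" "h \<in> L0 M"
  shows "meas_dist M U f h \<le> meas_dist M U f g + meas_dist M U h g"
proof -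
  have "meas_dist M U f h \<le> (\<integral>\<^sup>+x. ennreal (min \<bar>f x - g x\<bar> 1) * indicator U x
          + ennreal (min \<bar>h x - g x\<bar> 1) * indicator U x \<partial>M)"
    unfolding meas_dist_def
  proof (intro nn_integral_mono)
    fix x
    have "ennreal (min \<bar>f x - h x\<bar> 1)
            \<le> ennreal (min \<bar>f x - g x\<bar> 1 + min \<bar>h x - g x\<bar> 1)"
      by (intro ennreal_leI) linarith
    also have "\<dots> = ennreal (min \<bar>f x - g x\<bar> 1) + ennreal (min \<bar>h x - g x\<bar> 1)"
      by (intro ennreal_plus) auto
    finally show "ennreal (min \<bar>f x - h x\<bar> 1) * indicator U x
        \<le> ennreal (min \<bar>f x - g x\<bar> 1) * indicator U x
          + ennreal (min \<bar>h x - g x\<bar> 1) * indicator U x"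
      by (auto simp: indicator_def)
  qed
  also have "\<dots> = meas_dist M U f g + meas_dist M U h g"
    unfolding meas_dist_def using assms by (intro nn_integral_add) (auto intro!: borel_measurable_times_ennreal)
  finally show ?thesis .
qed

lemma limitin_tau:
  "limitin (tau M) f l F \<longleftrightarrow> l \<in> L0 M \<and> (\<forall>\<^sub>F i in F. f i \<in> L0 M)
     \<and> (\<forall>U\<in>sets M. emeasure M U < \<infinity> \<longrightarrow> ((\<lambda>i. meas_dist M U (f i) l) \<longlongrightarrow> 0) F)"
proof
  assume lim: "limitin (tau M) f l F"
  then have l: "l \<in> L0 M"
    using topspace_tau by (auto simp: limitin_def)
  have ev: "\<forall>\<^sub>F i in F. f i \<in> L0 M"
    using limitin_topspace[OF lim] lim openin_topspace[of "tau M"]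
    unfolding limitin_def topspace_tau by blast
  have "((\<lambda>i. meas_dist M U (f i) l) \<longlongrightarrow> 0) F" if U: "U \<in> sets M" "emeasure M U < \<infinity>" for U
  proof (rule order_tendstoI)
    fix a :: ennreal assume "0 < a"
    obtain r where r: "0 < r" "ennreal r < a"
      using dense[OF \<open>0 < a\<close>] by (metis ennreal_less_zero_iff less_top_ennreal order_less_le_trans top_greatest)
    let ?B = "{g \<in> L0 M. meas_dist M U l g < ennreal r}"
    have "openin (tau M) ?B"
      unfolding tau_def using U l r(1) by (intro topology_generated_by_Basis) blast
    moreover have "l \<in> ?B"
      using l r(1) by (simp add: meas_dist_def)
    ultimately have "\<forall>\<^sub>F i in F. f i \<in> ?B"
      using lim unfolding limitin_def by blast
    then show "\<forall>\<^sub>F i in F. meas_dist M U (f i) l < a"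
      by eventually_elim (use r(2) in \<open>auto simp: meas_dist_def abs_minus_commute\<close>)
  qed auto
  with l ev show "l \<in> L0 M \<and> (\<forall>\<^sub>F i in F. f i \<in> L0 M)
     \<and> (\<forall>U\<in>sets M. emeasure M U < \<infinity> \<longrightarrow> ((\<lambda>i. meas_dist M U (f i) l) \<longlongrightarrow> 0) F)"
    by blast
next
  assume asm: "l \<in> L0 M \<and> (\<forall>\<^sub>F i in F. f i \<in> L0 M)
     \<and> (\<forall>U\<in>sets M. emeasure M U < \<infinity> \<longrightarrow> ((\<lambda>i. meas_dist M U (f i) l) \<longlongrightarrow> 0) F)"
  show "limitin (tau M) f l F"
    unfolding limitin_def
  proof (intro conjI allI impI)
    show "l \<in> topspace (tau M)"
      using asm by (simp add: topspace_tau)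
    fix V assume "openin (tau M) V \<and> l \<in> V"
    then have "generate_topology_on {{g \<in> L0 M. meas_dist M U f g < ennreal r} | U f r.
        U \<in> sets M \<and> emeasure M U < \<infinity> \<and> f \<in> L0 M \<and> 0 < r} V" and "l \<in> V"
      by (auto simp: tau_def openin_topology_generated_by_iff)
    then show "\<forall>\<^sub>F i in F. f i \<in> V"
    proof (induction rule: generate_topology_on.induct)
      case (UN K)
      then obtain k where "k \<in> K" "l \<in> k" by blast
      with UN.IH[of k] show ?case
        by (auto elim: eventually_mono)
    next
      case (Basis s)
      then obtain U g r where s: "s = {h \<in> L0 M. meas_dist M U g h < ennreal r}"
        and U: "U \<in> sets M" "emeasure M U < \<infinity>" and g: "g \<in> L0 M" and r: "0 < r"
        by blast
      have less: "meas_dist M U g l < ennreal r"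
        using Basis s by blast
      have "((\<lambda>i. meas_dist M U g l + meas_dist M U (f i) l) \<longlongrightarrow> meas_dist M U g l + 0) F"
        using asm U by (intro tendsto_add tendsto_const) auto
      then have "\<forall>\<^sub>F i in F. meas_dist M U g l + meas_dist M U (f i) l < ennreal r"
        using less by (intro order_tendstoD(2)) auto
      moreover have "\<forall>\<^sub>F i in F. f i \<in> L0 M"
        using asm by blast
      ultimately show ?case
      proof eventually_elim
        case (elim i)
        with meas_dist_triangle[OF U(1) g _ elim(2), of l] asm show ?case
          by (auto simp: s)
      qed
    qed (auto simp: eventually_conj_iff)
  qed
qed


section \<open>Quadratic forms\<close>

definition quadratic_form :: "'a measure \<Rightarrow> (('a \<Rightarrow> real) \<Rightarrow> ennreal) \<Rightarrow> bool" where
  "quadratic_form M q \<longleftrightarrow>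
     (\<forall>u\<in>L0 M. \<forall>v\<in>L0 M. (AE x in M. u x = v x) \<longrightarrow> q u = q v)
     \<and> (\<forall>u\<in>L0 M. \<forall>v\<in>L0 M. 2 * q u + 2 * q v = q (\<lambda>x. u x + v x) + q (\<lambda>x. u x - v x))
     \<and> (\<forall>u\<in>L0 M. \<forall>c. q (\<lambda>x. c * u x) = ennreal (\<bar>c\<bar>\<^sup>2) * q u)"

definition form_dom :: "'a measure \<Rightarrow> (('a \<Rightarrow> real) \<Rightarrow> ennreal) \<Rightarrow> ('a \<Rightarrow> real) set" where
  "form_dom M q = {u \<in> L0 M. q u < \<infinity>}"

definition form_ker :: "'a measure \<Rightarrow> (('a \<Rightarrow> real) \<Rightarrow> ennreal) \<Rightarrow> ('a \<Rightarrow> real) set" where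
  "form_ker M q = {u \<in> L0 M. q u = 0}"

text \<open>Only meaningful for \<open>u\<close> and \<open>v\<close> in the domain of \<open>q\<close>, where all values are finite.\<close>

definition bilin :: "(('a \<Rightarrow> real) \<Rightarrow> ennreal) \<Rightarrow> ('a \<Rightarrow> real) \<Rightarrow> ('a \<Rightarrow> real) \<Rightarrow> real" where
  "bilin q u v = (enn2real (q (\<lambda>x. u x + v x)) - enn2real (q (\<lambda>x. u x - v x))) / 4"

definition seminorm_topology ::
    "'a measure \<Rightarrow> (('a \<Rightarrow> real) \<Rightarrow> ennreal) \<Rightarrow> ('a \<Rightarrow> real) topology" where
  "seminorm_topology M q = topology_generated_by
     {{g \<in> form_dom M q. sqrt (enn2real (q (\<lambda>x. g x - f x))) < r} | f r.
        f \<in> form_dom M q \<and> 0 < r}"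

definition form_topology ::
    "'a measure \<Rightarrow> (('a \<Rightarrow> real) \<Rightarrow> ennreal) \<Rightarrow> ('a \<Rightarrow> real) topology" where
  "form_topology M q = topology_generated_by
     ({S. openin (subtopology (tau M) (form_dom M q)) S} \<union> {S. openin (seminorm_topology M q) S})"

text \<open>Completeness of a vector space topology on a space of functions: every Cauchy filter
  (equivalently, every Cauchy net) converges.\<close>

definition cauchy_filter_in :: "('a \<Rightarrow> real) topology \<Rightarrow> ('a \<Rightarrow> real) filter \<Rightarrow> bool" where
  "cauchy_filter_in T F \<longleftrightarrow> F \<noteq> bot \<and> F \<le> principal (topspace T)
     \<and> (\<forall>V. openin T V \<and> (\<lambda>_. 0) \<in> V \<longrightarrow> (\<forall>\<^sub>F (f, g) in F \<times>\<^sub>F F. (\<lambda>x. f x - g x) \<in> V))"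

definition complete_in :: "('a \<Rightarrow> real) topology \<Rightarrow> bool" where
  "complete_in T \<longleftrightarrow> (\<forall>F. cauchy_filter_in T F \<longrightarrow> (\<exists>l. limitin T (\<lambda>f. f) l F))"

definition closed_form :: "'a measure \<Rightarrow> (('a \<Rightarrow> real) \<Rightarrow> ennreal) \<Rightarrow> bool" where
  "closed_form M q \<longleftrightarrow> complete_in (form_topology M q)"

definition form_extension ::
    "'a measure \<Rightarrow> (('a \<Rightarrow> real) \<Rightarrow> ennreal) \<Rightarrow> (('a \<Rightarrow> real) \<Rightarrow> ennreal) \<Rightarrow> bool" where
  "form_extension M q q' \<longleftrightarrow>
     form_dom M q \<subseteq> form_dom M q' \<and> (\<forall>f\<in>form_dom M q. q' f = q f)"


section \<open>Energy forms\<close>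

definition cutoff :: "real \<Rightarrow> (real \<Rightarrow> real) \<Rightarrow> bool" where
  "cutoff \<epsilon> C \<longleftrightarrow> mono C \<and> range C \<subseteq> {-\<epsilon>..1 + \<epsilon>}
     \<and> (\<forall>x y. \<bar>C x - C y\<bar> \<le> \<bar>x - y\<bar>) \<and> (\<forall>x\<in>{0..1}. C x = x)"

definition markovian :: "'a measure \<Rightarrow> (('a \<Rightarrow> real) \<Rightarrow> ennreal) \<Rightarrow> bool" where
  "markovian M E \<longleftrightarrow> (\<forall>\<epsilon>>0. \<exists>C. cutoff \<epsilon> C \<and> (\<forall>f\<in>L0 M. E (C \<circ> f) \<le> E f))"

definition energy_form :: "'a measure \<Rightarrow> (('a \<Rightarrow> real) \<Rightarrow> ennreal) \<Rightarrow> bool" where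
  "energy_form M E \<longleftrightarrow> quadratic_form M E \<and> closed_form M E \<and> markovian M E"

definition transient :: "'a measure \<Rightarrow> (('a \<Rightarrow> real) \<Rightarrow> ennreal) \<Rightarrow> bool" where
  "transient M E \<longleftrightarrow> form_ker M E = {u \<in> L0 M. AE x in M. u x = 0}"

definition silverstein_extension ::
    "'a measure \<Rightarrow> (('a \<Rightarrow> real) \<Rightarrow> ennreal) \<Rightarrow> (('a \<Rightarrow> real) \<Rightarrow> ennreal) \<Rightarrow> bool" where
  "silverstein_extension M E E' \<longleftrightarrow> energy_form M E' \<and> form_extension M E E'
     \<and> (\<forall>f \<in> form_dom M E \<inter> Linfty M. \<forall>g \<in> form_dom M E' \<inter> Linfty M.
          (\<lambda>x. f x * g x) \<in> form_dom M E)"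

definition superharmonic ::
    "'a measure \<Rightarrow> (('a \<Rightarrow> real) \<Rightarrow> ennreal) \<Rightarrow> ('a \<Rightarrow> real) \<Rightarrow> bool" where
  "superharmonic M E h \<longleftrightarrow> h \<in> form_dom M E
     \<and> (\<forall>\<psi>\<in>form_dom M E. (AE x in M. 0 \<le> \<psi> x) \<longrightarrow> 0 \<le> bilin E h \<psi>)"

definition cap ::
    "'a measure \<Rightarrow> (('a \<Rightarrow> real) \<Rightarrow> ennreal) \<Rightarrow> ('a \<Rightarrow> real) \<Rightarrow> 'a set \<Rightarrow> ennreal" where
  "cap M E h U =
     Inf {E f | f. f \<in> L0 M \<and> (AE x in M. h x * indicator U x \<le> f x * indicator U x)}"


section \<open>Nests\<close>

definition nest_dom ::
    "'a measure \<Rightarrow> (('a \<Rightarrow> real) \<Rightarrow> ennreal) \<Rightarrow> 'a set set \<Rightarrow> ('a \<Rightarrow> real) set" where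
  "nest_dom M E \<N> =
     {f \<in> form_dom M E. \<exists>N\<in>\<N>. AE x in M. f x * indicator (space M - N) x = 0}"

definition linear_subspace :: "('a \<Rightarrow> real) set \<Rightarrow> bool" where
  "linear_subspace V \<longleftrightarrow> (\<lambda>_. 0) \<in> V
     \<and> (\<forall>f\<in>V. \<forall>g\<in>V. (\<lambda>x. f x + g x) \<in> V) \<and> (\<forall>c. \<forall>f\<in>V. (\<lambda>x. c * f x) \<in> V)"

definition nest :: "'a measure \<Rightarrow> (('a \<Rightarrow> real) \<Rightarrow> ennreal) \<Rightarrow> 'a set set \<Rightarrow> bool" where
  "nest M E \<N> \<longleftrightarrow> \<N> \<subseteq> sets M \<and> linear_subspace (nest_dom M E \<N>)
     \<and> form_topology M E closure_of nest_dom M E \<N> = form_dom M E"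

definition special_nest :: "'a measure \<Rightarrow> (('a \<Rightarrow> real) \<Rightarrow> ennreal) \<Rightarrow> 'a set set \<Rightarrow> bool" where
  "special_nest M E \<N> \<longleftrightarrow> nest M E \<N>
     \<and> (\<forall>N\<in>\<N>. \<exists>g\<in>nest_dom M E \<N>. AE x in M. indicator N x \<le> g x)"

end

(* A closed form is lower semicontinuous along almost everywhere convergent sequences, by the
   parallelogram law. Hence the cutoffs give contraction under clamping, and the level sets {f > c},
   with f in the domain and c > 0, form a special nest, because truncations at height c -> 0 have
   vanishing energy; this is (ii) ==> (i). For (iii) ==> (ii), approximate h itself by
   functions f vanishing off N and use h - f as a competitor for the capacity.
   For (i) ==> (iii), superharmonicity of h gives competitors 0 <= e_n <= h of summable energy for
   complements of sets N_n. Their tail suprema stay below h and have energy tending to 0, so e_n -> 0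
   almost everywhere by transience. If 0 <= f <= min(1, h) lies in the domain of the extension, then
   (f - e_n)^+ is supported in N_n, hence lies in D(E) by the Silverstein property, and lower
   semicontinuity of E puts f into D(E). *)

theory Submission
  imports Defs
begin

section \<open>Convergence in generated topologies and in measure\<close>

text \<open>Closedness speaks of Cauchy filters in a topology on representatives, whereas the limits
  below are almost everywhere limits of sequences. Semi-finiteness connects the two: it makes limits
  in \<open>tau M\<close> unique up to null sets, so the limit supplied by completeness is the
  pointwise one. Lower semicontinuity then follows without weak compactness. In (i) ==> (iii) the
  Silverstein property concerns products of bounded functions. The nest is special in order to
  supply, for each \<open>N\<close>, a function of D(E) that is at least 1 on \<open>N\<close>;
  clamped to [0, 1] it multiplies (f - e_n)^+ without changing it. The bound e_n <= h keeps the tail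
  suprema real-valued. A general f >= 0 is reached through (n + 1) min(f / (n + 1), h, 1), which
  equals f for large n wherever h > 0; the cuts at 1 and at the superharmonic \<open>h\<close> do
  not raise the energy, and the two scalings cancel.\<close>

lemma limitin_topology_generated_by:
  "limitin (topology_generated_by S) f l F \<longleftrightarrow>
     l \<in> \<Union>S \<and> (\<forall>s\<in>S. l \<in> s \<longrightarrow> (\<forall>\<^sub>F i in F. f i \<in> s))" (is "?L \<longleftrightarrow> ?R")
proof
  assume ?L
  then show ?R
    unfolding limitin_def using topology_generated_by_Basis
    by (auto simp: topology_generated_by_topspace)
next
  assume R: ?R
  have "\<forall>\<^sub>F i in F. f i \<in> V" if "generate_topology_on S V" "l \<in> V" for V
    using that
  proof (induction rule: generate_topology_on.induct)
    case (UN K)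
    then obtain k where "k \<in> K" "l \<in> k" by blast
    with UN.IH[of k] show ?case
      by (auto elim: eventually_mono)
  next
    case (Basis s)
    with R show ?case by blast
  qed (auto simp: eventually_conj_iff)
  with R show ?L
    unfolding limitin_def by (auto simp: openin_topology_generated_by_iff topology_generated_by_topspace)
qed

lemma tendsto_meas_dist_AE:
  assumes U: "U \<in> sets M" "emeasure M U < \<infinity>"
    and meas [measurable]: "\<And>n. u n \<in> L0 M" "l \<in> L0 M"
    and lim: "AE x in M. (\<lambda>n. u n x) \<longlonglongrightarrow> l x"
  shows "(\<lambda>n. meas_dist M U (u n) l) \<longlonglongrightarrow> 0"
proof -
  note U(1)[measurable]
  have "(\<lambda>n. meas_dist M U (u n) l) \<longlonglongrightarrow> (\<integral>\<^sup>+x. 0 \<partial>M)"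
    unfolding meas_dist_def
  proof (rule nn_integral_dominated_convergence[where w = "indicator U"])
    show "AE x in M. ennreal (min \<bar>u n x - l x\<bar> 1) * indicator U x \<le> indicator U x" for n
      by (auto simp: indicator_def ennreal_le_1)
    show "AE x in M. (\<lambda>n. ennreal (min \<bar>u n x - l x\<bar> 1) * indicator U x) \<longlonglongrightarrow> 0"
      using lim
    proof eventually_elim
      case (elim x)
      have "(\<lambda>n. ennreal (min \<bar>u n x - l x\<bar> 1)) \<longlonglongrightarrow> ennreal (min \<bar>l x - l x\<bar> 1)"
        by (intro tendsto_intros elim)
      then show ?case
        by (cases "x \<in> U") auto
    qed
  qed (use U in auto)
  then show ?thesis by simp
qed

lemma meas_dist_eq_0_iff:
  assumes "U \<in> sets M" "u \<in> L0 M" "v \<in> L0 M"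
  shows "meas_dist M U u v = 0 \<longleftrightarrow> (AE x in M. x \<in> U \<longrightarrow> u x = v x)"
proof -
  note assms[measurable]
  have "meas_dist M U u v = 0 \<longleftrightarrow> (AE x in M. ennreal (min \<bar>u x - v x\<bar> 1) * indicator U x = 0)"
    unfolding meas_dist_def by (intro nn_integral_0_iff_AE) measurable
  also have "\<dots> \<longleftrightarrow> (AE x in M. x \<in> U \<longrightarrow> u x = v x)"
    by (intro AE_cong) (auto simp: indicator_def ennreal_eq_0_iff min_def)
  finally show ?thesis .
qed

text \<open>An exceptional set of infinite measure would contain a set of positive finite measure,
  on which the local hypothesis already excludes exceptions.\<close>

lemma AE_of_locally_AE:
  assumes sf: "semi_finite M" and meas: "{x \<in> space M. \<not> P x} \<in> sets M"
    and loc: "\<And>U. U \<in> sets M \<Longrightarrow> emeasure M U < \<infinity> \<Longrightarrow> AE x in M. x \<in> U \<longrightarrow> P x"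
  shows "AE x in M. P x"
proof -
  let ?A = "{x \<in> space M. \<not> P x}"
  have null: "emeasure M U = 0" if U: "U \<in> sets M" "U \<subseteq> ?A" "emeasure M U < \<infinity>" for U
  proof -
    have "AE x in M. x \<notin> U"
      using loc[OF U(1,3)] by eventually_elim (use U(2) in auto)
    then show ?thesis
      using AE_iff_measurable[OF U(1), of "\<lambda>x. x \<notin> U"] sets.sets_into_space[OF U(1)] by auto
  qed
  have "emeasure M ?A = 0"
  proof (cases "emeasure M ?A = \<infinity>")
    case True
    then obtain U where "U \<in> sets M" "U \<subseteq> ?A" "0 < emeasure M U" "emeasure M U < \<infinity>"
      using sf meas unfolding semi_finite_def by blast
    then show ?thesis using null[of U] by simp
  next
    case False
    then show ?thesis using null[OF meas] by (simp add: less_top)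
  qed
  then show ?thesis
    using meas by (simp add: AE_iff_measurable[OF meas refl])
qed

text \<open>The triangle inequality through \<open>f i\<close> gives distance 0 on every set of
  finite measure; semi-finiteness makes this global.\<close>

lemma limitin_tau_AE_unique:
  assumes sf: "semi_finite M" and F: "F \<noteq> bot" and l: "limitin (tau M) f l F" and k: "limitin (tau M) f k F"
  shows "AE x in M. l x = k x"
proof (rule AE_of_locally_AE[OF sf])
  have [measurable]: "l \<in> L0 M" "k \<in> L0 M"
    using l k by (auto simp: limitin_tau)
  show "{x \<in> space M. l x \<noteq> k x} \<in> sets M"
    by measurable
  fix U assume U: "U \<in> sets M" "emeasure M U < \<infinity>"
  have "((\<lambda>i. meas_dist M U (f i) l + meas_dist M U (f i) k) \<longlongrightarrow> 0 + 0) F"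
    using l k U by (intro tendsto_intros) (auto simp: limitin_tau)
  moreover have "\<forall>\<^sub>F i in F. f i \<in> L0 M"
    using l by (simp add: limitin_tau)
  then have "\<forall>\<^sub>F i in F. meas_dist M U l k \<le> meas_dist M U (f i) l + meas_dist M U (f i) k"
  proof eventually_elim
    case (elim i)
    then show ?case
      using meas_dist_triangle[of U M l "f i" k] U
      by (simp add: meas_dist_def abs_minus_commute)
  qed
  ultimately have "meas_dist M U l k \<le> 0 + 0"
    by (rule tendsto_lowerbound[OF _ _ F])
  then show "AE x in M. x \<in> U \<longrightarrow> l x = k x"
    using U by (simp add: meas_dist_eq_0_iff)
qed


section \<open>Quadratic forms\<close>

locale quad_form =
  fixes M :: "'a measure" and q :: "('a \<Rightarrow> real) \<Rightarrow> ennreal"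
  assumes qf: "quadratic_form M q"
begin

abbreviation "D \<equiv> form_dom M q"
abbreviation "Q u \<equiv> enn2real (q u)"
abbreviation "B \<equiv> bilin q"

lemma dom_L0: "u \<in> D \<Longrightarrow> u \<in> L0 M"
  by (simp add: form_dom_def)

lemma q_cong: "u \<in> L0 M \<Longrightarrow> v \<in> L0 M \<Longrightarrow> AE x in M. u x = v x \<Longrightarrow> q u = q v"
  using qf unfolding quadratic_form_def by blast

lemma dom_cong: "u \<in> D \<Longrightarrow> v \<in> L0 M \<Longrightarrow> AE x in M. u x = v x \<Longrightarrow> v \<in> D"
  using q_cong[of u v] by (auto simp: form_dom_def)

lemma q_parallelogram:
  "u \<in> L0 M \<Longrightarrow> v \<in> L0 M \<Longrightarrow> 2 * q u + 2 * q v = q (\<lambda>x. u x + v x) + q (\<lambda>x. u x - v x)"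
  using qf unfolding quadratic_form_def by blast

lemma q_scale: "u \<in> L0 M \<Longrightarrow> q (\<lambda>x. c * u x) = ennreal (c\<^sup>2) * q u"
  using qf unfolding quadratic_form_def by (metis power2_abs)

lemma q_minus: "u \<in> L0 M \<Longrightarrow> q (\<lambda>x. - u x) = q u"
  using q_scale[of u "-1"] by simp

lemma q_diff_commute: "u \<in> L0 M \<Longrightarrow> v \<in> L0 M \<Longrightarrow> q (\<lambda>x. u x - v x) = q (\<lambda>x. v x - u x)"
  using q_minus[of "\<lambda>x. u x - v x"] by simp

lemma q_zero: "q (\<lambda>x. 0) = 0"
  using q_scale[of "\<lambda>x. 0" 0] by simp

lemma q_eq_Q: "u \<in> D \<Longrightarrow> q u = ennreal (Q u)"
  by (simp add: form_dom_def)

lemma dom_zero: "(\<lambda>x. 0) \<in> D"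
  by (simp add: form_dom_def q_zero)

lemma dom_scale: "u \<in> D \<Longrightarrow> (\<lambda>x. c * u x) \<in> D"
  using q_scale[of u c] by (auto simp: form_dom_def ennreal_mult_less_top)

lemma q_add_diff_finite:
  assumes "u \<in> D" "v \<in> D"
  shows "q (\<lambda>x. u x + v x) + q (\<lambda>x. u x - v x) < \<infinity>"
proof -
  have "2 * q u + 2 * q v < \<infinity>"
    using assms by (auto simp: form_dom_def ennreal_mult_less_top)
  then show ?thesis
    using q_parallelogram[of u v] assms by (simp add: dom_L0)
qed

lemma dom_add: "u \<in> D \<Longrightarrow> v \<in> D \<Longrightarrow> (\<lambda>x. u x + v x) \<in> D"
  and dom_diff: "u \<in> D \<Longrightarrow> v \<in> D \<Longrightarrow> (\<lambda>x. u x - v x) \<in> D"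
  using q_add_diff_finite[of u v] by (auto simp: form_dom_def)

lemma Q_parallelogram:
  assumes "u \<in> D" "v \<in> D"
  shows "Q (\<lambda>x. u x + v x) + Q (\<lambda>x. u x - v x) = 2 * Q u + 2 * Q v"
proof -
  have "2 * Q u + 2 * Q v = enn2real (2 * q u + 2 * q v)"
    using assms by (simp add: form_dom_def enn2real_plus enn2real_mult ennreal_mult_less_top)
  also have "\<dots> = Q (\<lambda>x. u x + v x) + Q (\<lambda>x. u x - v x)"
    using dom_add[OF assms] dom_diff[OF assms] assms
    by (simp add: q_parallelogram enn2real_plus form_dom_def)
  finally show ?thesis ..
qed

lemma Q_scale: "u \<in> D \<Longrightarrow> Q (\<lambda>x. c * u x) = c\<^sup>2 * Q u"
  by (simp add: q_scale dom_L0 enn2real_mult)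

section \<open>The induced bilinear form and the Cauchy-Schwarz inequality\<close>

lemma Q_add: "u \<in> D \<Longrightarrow> v \<in> D \<Longrightarrow> Q (\<lambda>x. u x + v x) = Q u + 2 * B u v + Q v"
  and Q_diff: "u \<in> D \<Longrightarrow> v \<in> D \<Longrightarrow> Q (\<lambda>x. u x - v x) = Q u - 2 * B u v + Q v"
  using Q_parallelogram[of u v] by (simp_all add: bilin_def field_simps)

lemma B_commute: "u \<in> L0 M \<Longrightarrow> v \<in> L0 M \<Longrightarrow> B u v = B v u"
  by (simp add: bilin_def q_diff_commute[of u v] add.commute)

text \<open>The Jordan-von Neumann argument: three parallelograms share the terms in
  \<open>u\<close>, \<open>v\<close>, \<open>w\<close>, and eliminating the unwanted ones is linear
  arithmetic.\<close>

lemma B_add_left: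
  assumes u: "u \<in> D" and v: "v \<in> D" and w: "w \<in> D"
  shows "B (\<lambda>x. u x + v x) w = B u w + B v w"
proof -
  let ?S = "Q (\<lambda>x. u x + v x + w x)"
  have 1: "?S + Q (\<lambda>x. u x + w x - v x) = 2 * Q (\<lambda>x. u x + w x) + 2 * Q v"
    using Q_parallelogram[OF dom_add[OF u w] v] by (simp add: ac_simps)
  have 2: "?S + Q (\<lambda>x. v x + w x - u x) = 2 * Q (\<lambda>x. v x + w x) + 2 * Q u"
    using Q_parallelogram[OF dom_add[OF v w] u] by (simp add: ac_simps)
  have 3: "Q (\<lambda>x. u x + w x - v x) + Q (\<lambda>x. v x + w x - u x) = 2 * Q w + 2 * Q (\<lambda>x. u x - v x)"
    using Q_parallelogram[OF w dom_diff[OF u v]] by (simp add: algebra_simps)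
  show ?thesis
    using 1 2 3 Q_parallelogram[OF u v] Q_add[OF dom_add[OF u v] w] Q_add[OF u w] Q_add[OF v w]
    by linarith
qed

lemma abs_B_le: "u \<in> D \<Longrightarrow> v \<in> D \<Longrightarrow> 2 * \<bar>B u v\<bar> \<le> Q u + Q v"
  using Q_add[of u v] Q_diff[of u v] enn2real_nonneg[of "q (\<lambda>x. u x + v x)"]
    enn2real_nonneg[of "q (\<lambda>x. u x - v x)"] by linarith

lemma B_scale_left:
  assumes u: "u \<in> D" and v: "v \<in> D"
  shows "B (\<lambda>x. c * u x) v = c * B u v"
proof -
  define \<psi> where "\<psi> c = B (\<lambda>x. c * u x) v - c * B u v" for c
  have add: "\<psi> (a + b) = \<psi> a + \<psi> b" for a b
    using B_add_left[OF dom_scale[OF u, of a] dom_scale[OF u, of b] v]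
    by (simp add: \<psi>_def algebra_simps)
  have zero: "\<psi> 0 = 0"
    using add[of 0 0] by simp
  have mult: "\<psi> (real n * a) = real n * \<psi> a" for n a
    by (induction n) (auto simp: zero algebra_simps add)
  have uminus: "\<psi> (- a) = - \<psi> a" for a
    using add[of a "-a"] zero by simp
  have one: "\<psi> 1 = 0"
    by (simp add: \<psi>_def)
  have int: "\<psi> (of_int k) = 0" for k
    using mult[of "nat k" 1] mult[of "nat (-k)" 1] uminus[of "of_int k"] one
    by (cases "k \<ge> 0") auto
  have bnd: "\<bar>\<psi> a\<bar> \<le> Q u + Q v + \<bar>B u v\<bar>" for a
  proof -
    have "\<psi> a = \<psi> (frac a)"
      using add[of "frac a" "of_int \<lfloor>a\<rfloor>"] int by (simp add: frac_def)
    moreover have "2 * \<bar>B (\<lambda>x. frac a * u x) v\<bar> \<le> (frac a)\<^sup>2 * Q u + Q v"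
      using abs_B_le[OF dom_scale[OF u, of "frac a"] v] by (simp add: Q_scale u)
    moreover have "(frac a)\<^sup>2 \<le> 1"
      using frac_ge_0[of a] frac_lt_1[of a] by (simp add: power_le_one)
    then have "(frac a)\<^sup>2 * Q u \<le> Q u"
      by (simp add: mult_left_le_one_le)
    moreover have "\<bar>frac a * B u v\<bar> \<le> \<bar>B u v\<bar>"
      using frac_ge_0[of a] frac_lt_1[of a] by (simp add: abs_mult mult_left_le_one_le)
    ultimately show ?thesis
      unfolding \<psi>_def using enn2real_nonneg[of "q u"] enn2real_nonneg[of "q v"] by linarith
  qed
  have "\<psi> c = 0"
  proof (rule ccontr)
    assume "\<psi> c \<noteq> 0"
    then obtain n :: nat where "Q u + Q v + \<bar>B u v\<bar> < of_nat n * \<bar>\<psi> c\<bar>"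
      using ex_less_of_nat_mult[of "\<bar>\<psi> c\<bar>"] by auto
    then show False
      using bnd[of "real n * c"] by (simp add: mult abs_mult)
  qed
  then show ?thesis
    by (simp add: \<psi>_def)
qed

lemma Q_add_scale:
  assumes "u \<in> D" "v \<in> D"
  shows "Q (\<lambda>x. u x + t * v x) = Q u + 2 * t * B u v + t\<^sup>2 * Q v"
  using Q_add[OF assms(1) dom_scale[OF assms(2), of t]] assms
  by (simp add: Q_scale B_commute[of u] dom_L0 dom_scale B_scale_left)

text \<open>First variation: 2 B(u, v) is the one-sided derivative at t = 0. This is the source of
  all sign statements for cross terms below.\<close>

lemma B_nonneg_of_minimal:
  assumes u: "u \<in> D" and v: "v \<in> D" and min: "\<And>t. 0 < t \<Longrightarrow> Q u \<le> Q (\<lambda>x. u x + t * v x)"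
  shows "0 \<le> B u v"
proof (rule ccontr)
  assume neg: "\<not> 0 \<le> B u v"
  \<comment> \<open>Small enough that t Q(v) < -B(u, v), so the linear term wins; the summand 1
    covers Q(v) = 0.\<close>
  define t where "t = - B u v / (Q v + 1)"
  have "0 < Q v + 1"
    by (simp add: add_nonneg_pos)
  then have t: "0 < t" "t * (Q v + 1) = - B u v"
    using neg by (simp_all add: t_def divide_neg_pos)
  have "0 \<le> t * (2 * B u v + t * Q v)"
    using min[OF t(1)] by (simp add: Q_add_scale u v power2_eq_square algebra_simps)
  then have "0 \<le> 2 * B u v + t * Q v"
    using t(1) by (simp add: zero_le_mult_iff)
  then show False
    using t neg by (simp add: algebra_simps)
qed

lemma Cauchy_Schwarz:
  assumes u: "u \<in> D" and v: "v \<in> D"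
  shows "\<bar>B u v\<bar> \<le> sqrt (Q u) * sqrt (Q v)"
proof -
  have "(2 * B u v)\<^sup>2 - 4 * Q v * Q u \<le> 0"
  proof (rule ccontr)
    assume pos: "\<not> ?thesis"
    show False
    proof (cases "Q v = 0")
      case True
      then have "B u v \<noteq> 0" using pos by auto
      \<comment> \<open>With Q(v) = 0 the polynomial in t is affine, and this t gives it the value
        -1.\<close>
      then have "Q (\<lambda>x. u x + (- (Q u + 1) / (2 * B u v)) * v x) < 0"
        using True unfolding Q_add_scale[OF u v] by (simp add: field_simps)
      then show ?thesis
        by (meson enn2real_nonneg not_less)
    next
      case False
      then have "0 < Q v" by (simp add: less_le)
      \<comment> \<open>The value of the polynomial at its minimizer t = -B(u, v) / Q(v).\<close>
      then have "Q u + 2 * (- B u v / Q v) * B u v + (- B u v / Q v)\<^sup>2 * Q v = Q u - (B u v)\<^sup>2 / Q v"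
        by (simp add: field_simps power2_eq_square)
      moreover have "Q u - (B u v)\<^sup>2 / Q v < 0"
        using pos \<open>0 < Q v\<close> by (simp add: field_simps power2_eq_square)
      ultimately show ?thesis
        using Q_add_scale[OF u v, of "- B u v / Q v"]
        by (metis enn2real_nonneg not_less)
    qed
  qed
  then have "(B u v)\<^sup>2 \<le> Q u * Q v"
    by (simp add: power_mult_distrib mult.commute)
  then show ?thesis
    by (metis real_sqrt_abs real_sqrt_le_mono real_sqrt_mult)
qed

lemma tendsto_Q_diff:
  assumes l: "l \<in> D" and f: "f \<in> D" and ev: "\<forall>\<^sub>F i in F. g i \<in> D"
    and lim: "((\<lambda>i. Q (\<lambda>x. g i x - l x)) \<longlongrightarrow> 0) F"
  shows "((\<lambda>i. Q (\<lambda>x. g i x - f x)) \<longlongrightarrow> Q (\<lambda>x. l x - f x)) F"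
proof -
  let ?r = "\<lambda>i. Q (\<lambda>x. g i x - l x)" and ?c = "Q (\<lambda>x. l x - f x)"
  have "((\<lambda>i. sqrt (?r i) * sqrt ?c) \<longlongrightarrow> sqrt 0 * sqrt ?c) F"
    by (intro tendsto_intros lim)
  then have "((\<lambda>i. B (\<lambda>x. g i x - l x) (\<lambda>x. l x - f x)) \<longlongrightarrow> 0) F"
  proof (rule Lim_null_comparison[rotated, OF tendsto_eq_rhs])
    show "\<forall>\<^sub>F i in F. norm (B (\<lambda>x. g i x - l x) (\<lambda>x. l x - f x)) \<le> sqrt (?r i) * sqrt ?c"
      using ev by eventually_elim (auto intro!: Cauchy_Schwarz dom_diff l f)
  qed simp
  then have "((\<lambda>i. ?r i + 2 * B (\<lambda>x. g i x - l x) (\<lambda>x. l x - f x) + ?c) \<longlongrightarrow> 0 + 2 * 0 + ?c) F"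
    by (intro tendsto_intros lim)
  moreover have "\<forall>\<^sub>F i in F. ?r i + 2 * B (\<lambda>x. g i x - l x) (\<lambda>x. l x - f x) + ?c
      = Q (\<lambda>x. g i x - f x)"
    using ev
  proof eventually_elim
    case (elim i)
    show ?case
      using Q_add[OF dom_diff[OF elim l] dom_diff[OF l f]] by simp
  qed
  ultimately show ?thesis
    using tendsto_cong by (simp add: filterlim_cong)
qed

section \<open>Convergence in the form topology\<close>

lemma openin_form_topology:
  "openin (tau M) V \<Longrightarrow> openin (form_topology M q) (V \<inter> D)"
  "f \<in> D \<Longrightarrow> 0 < r \<Longrightarrow> openin (form_topology M q) {g \<in> D. sqrt (Q (\<lambda>x. g x - f x)) < r}"
  unfolding form_topology_def seminorm_topology_def
  by (rule topology_generated_by_Basis; auto simp: openin_subtopology intro: topology_generated_by_Basis)+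

text \<open>A generating ball may be centred at any \<open>f\<close>, not only at the limit, so
  convergence of the distance to \<open>l\<close> is first transferred to \<open>f\<close> by
  \<open>tendsto_Q_diff\<close>.\<close>

lemma limitin_seminorm_topology:
  assumes l: "l \<in> D" and ev: "\<forall>\<^sub>F i in F. g i \<in> D"
    and lim: "((\<lambda>i. Q (\<lambda>x. g i x - l x)) \<longlongrightarrow> 0) F"
  shows "limitin (seminorm_topology M q) g l F"
  unfolding seminorm_topology_def limitin_topology_generated_by
proof (intro conjI ballI impI)
  have "l \<in> {g \<in> D. sqrt (Q (\<lambda>x. g x - l x)) < 1}"
    using l by (simp add: q_zero)
  with l show "l \<in> \<Union> {{g \<in> D. sqrt (Q (\<lambda>x. g x - f x)) < r} | f r. f \<in> D \<and> 0 < r}"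
    using zero_less_one by blast
next
  fix s assume "s \<in> {{g \<in> D. sqrt (Q (\<lambda>x. g x - f x)) < r} | f r. f \<in> D \<and> 0 < r}" "l \<in> s"
  then obtain f r where s: "s = {g \<in> D. sqrt (Q (\<lambda>x. g x - f x)) < r}" and f: "f \<in> D"
    and less: "sqrt (Q (\<lambda>x. l x - f x)) < r" by blast
  have "((\<lambda>i. sqrt (Q (\<lambda>x. g i x - f x))) \<longlongrightarrow> sqrt (Q (\<lambda>x. l x - f x))) F"
    by (intro tendsto_intros tendsto_Q_diff l f ev lim)
  from order_tendstoD(2)[OF this less] ev show "\<forall>\<^sub>F i in F. g i \<in> s"
    by eventually_elim (auto simp: s)
qed

lemma limitin_form_topologyI:
  assumes l: "l \<in> D" and ev: "\<forall>\<^sub>F i in F. g i \<in> D" and tau: "limitin (tau M) g l F"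
    and lim: "((\<lambda>i. Q (\<lambda>x. g i x - l x)) \<longlongrightarrow> 0) F"
  shows "limitin (form_topology M q) g l F"
  unfolding form_topology_def limitin_topology_generated_by
proof (intro conjI ballI impI)
  have "openin (subtopology (tau M) D) D"
    using dom_L0 by (auto simp: openin_subtopology topspace_tau intro!: exI[of _ "L0 M"])
      (metis openin_topspace topspace_tau)
  with l show "l \<in> \<Union> ({S. openin (subtopology (tau M) D) S} \<union> {S. openin (seminorm_topology M q) S})"
    by blast
next
  fix s assume s: "s \<in> {S. openin (subtopology (tau M) D) S} \<union> {S. openin (seminorm_topology M q) S}" "l \<in> s"
  then consider "openin (subtopology (tau M) D) s" | "openin (seminorm_topology M q) s" by blast
  then show "\<forall>\<^sub>F i in F. g i \<in> s"
  proof cases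
    case 1
    then obtain T where T: "openin (tau M) T" "s = T \<inter> D"
      by (auto simp: openin_subtopology)
    then have "\<forall>\<^sub>F i in F. g i \<in> T"
      using tau s(2) by (auto simp: limitin_def)
    with ev show ?thesis
      by eventually_elim (simp add: T)
  next
    case 2
    with limitin_seminorm_topology[OF l ev lim] s(2) show ?thesis
      by (auto simp: limitin_def)
  qed
qed

lemma topspace_form_topology: "topspace (form_topology M q) = D"
proof
  show "D \<subseteq> topspace (form_topology M q)"
  proof
    fix f assume "f \<in> D"
    then have "f \<in> {g \<in> D. sqrt (Q (\<lambda>x. g x - f x)) < 1}"
      by (simp add: q_zero)
    with openin_form_topology(2)[OF \<open>f \<in> D\<close> zero_less_one] show "f \<in> topspace (form_topology M q)"
      using openin_subset by blast
  qed
  have "S \<subseteq> D" if "openin (seminorm_topology M q) S" for S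
    using openin_subset[OF that] unfolding seminorm_topology_def topology_generated_by_topspace by blast
  then show "topspace (form_topology M q) \<subseteq> D"
    unfolding form_topology_def topology_generated_by_topspace
    by (auto simp: openin_subtopology)
qed

lemma limitin_form_topologyD:
  assumes lim: "limitin (form_topology M q) g l F"
  shows "l \<in> D" "\<forall>\<^sub>F i in F. g i \<in> D" "limitin (tau M) g l F"
    "((\<lambda>i. Q (\<lambda>x. g i x - l x)) \<longlongrightarrow> 0) F"
proof -
  show l: "l \<in> D"
    using lim by (simp add: limitin_def topspace_form_topology)
  show "\<forall>\<^sub>F i in F. g i \<in> D"
    using lim openin_topspace[of "form_topology M q"] l
    unfolding limitin_def topspace_form_topology by blast
  show "limitin (tau M) g l F"
    unfolding limitin_def
  proof (intro conjI allI impI)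
    show "l \<in> topspace (tau M)"
      using dom_L0[OF l] by (simp add: topspace_tau)
    fix V assume "openin (tau M) V \<and> l \<in> V"
    then have "\<forall>\<^sub>F i in F. g i \<in> V \<inter> D"
      using lim l openin_form_topology(1) unfolding limitin_def by blast
    then show "\<forall>\<^sub>F i in F. g i \<in> V"
      by (rule eventually_mono) simp
  qed
  show "((\<lambda>i. Q (\<lambda>x. g i x - l x)) \<longlongrightarrow> 0) F"
  proof (rule order_tendstoI)
    fix a :: real assume "0 < a"
    then have "l \<in> {g \<in> D. sqrt (Q (\<lambda>x. g x - l x)) < sqrt a}"
      using l by (simp add: q_zero)
    then have "\<forall>\<^sub>F i in F. g i \<in> {g \<in> D. sqrt (Q (\<lambda>x. g x - l x)) < sqrt a}"
      using lim openin_form_topology(2)[OF l, of "sqrt a"] \<open>0 < a\<close> unfolding limitin_def by auto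
    then show "\<forall>\<^sub>F i in F. Q (\<lambda>x. g i x - l x) < a"
      by (rule eventually_mono) simp
  qed (auto intro!: always_eventually less_le_trans[OF _ enn2real_nonneg])
qed

end


section \<open>Lower semicontinuity of closed forms\<close>

locale closed_quad_form = quad_form +
  assumes sf: "semi_finite M" and closed: "closed_form M q"
begin

lemma limitin_tau_AE:
  assumes "\<And>n. v n \<in> L0 M" "u \<in> L0 M" "AE x in M. (\<lambda>n. v n x) \<longlonglongrightarrow> u x"
  shows "limitin (tau M) v u sequentially"
  using assms by (auto simp: limitin_tau intro: tendsto_meas_dist_AE)

text \<open>Almost everywhere convergence already makes the differences small in
  \<open>tau M\<close>, so energy Cauchyness suffices for the image filter of \<open>v\<close> to be
  Cauchy in the form topology. Its limit agrees with \<open>u\<close> almost everywhere.\<close>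

lemma Cauchy_AE_limit:
  assumes v: "\<And>n. v n \<in> D" and u: "u \<in> L0 M" and lim: "AE x in M. (\<lambda>n. v n x) \<longlonglongrightarrow> u x"
    and Cauchy: "((\<lambda>(i, j). Q (\<lambda>x. v i x - v j x)) \<longlongrightarrow> 0) (sequentially \<times>\<^sub>F sequentially)"
  shows "u \<in> D" "(\<lambda>n. Q (\<lambda>x. v n x - u x)) \<longlonglongrightarrow> 0"
proof -
  define F where "F = filtermap v sequentially"
  have tau_u: "limitin (tau M) v u sequentially"
    using v dom_L0 by (intro limitin_tau_AE u lim) auto
  have tau_diff: "limitin (tau M) (\<lambda>p x. v (fst p) x - v (snd p) x) (\<lambda>x. 0) (sequentially \<times>\<^sub>F sequentially)"
    unfolding limitin_tau
  proof (intro conjI ballI impI always_eventually allI)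
    show "(\<lambda>x. v (fst p) x - v (snd p) x) \<in> L0 M" for p
      using dom_L0[OF dom_diff[OF v v]] .
    fix U assume U: "U \<in> sets M" "emeasure M U < \<infinity>"
    let ?d = "\<lambda>n. meas_dist M U (v n) u"
    have d: "?d \<longlonglongrightarrow> 0"
      using tau_u U by (simp add: limitin_tau)
    have "((\<lambda>p. ?d (fst p) + ?d (snd p)) \<longlongrightarrow> 0 + 0) (sequentially \<times>\<^sub>F sequentially)"
      by (intro tendsto_add filterlim_compose[OF d] filterlim_fst filterlim_snd)
    then have d2: "((\<lambda>p. ?d (fst p) + ?d (snd p)) \<longlongrightarrow> 0) (sequentially \<times>\<^sub>F sequentially)"
      by simp
    have "meas_dist M U (\<lambda>x. v (fst p) x - v (snd p) x) (\<lambda>x. 0) \<le> ?d (fst p) + ?d (snd p)" for p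
      using meas_dist_triangle[of U M "v (fst p)" u "v (snd p)"] U u v dom_L0
      by (simp add: meas_dist_def)
    then show "((\<lambda>p. meas_dist M U (\<lambda>x. v (fst p) x - v (snd p) x) (\<lambda>x. 0)) \<longlongrightarrow> 0)
        (sequentially \<times>\<^sub>F sequentially)"
      by (intro tendsto_sandwich[OF _ _ tendsto_const d2] always_eventually) auto
  qed simp
  have form_diff: "limitin (form_topology M q) (\<lambda>p x. v (fst p) x - v (snd p) x) (\<lambda>x. 0)
      (sequentially \<times>\<^sub>F sequentially)"
    using Cauchy by (intro limitin_form_topologyI tau_diff dom_zero always_eventually allI dom_diff v)
      (simp add: case_prod_unfold)
  have "cauchy_filter_in (form_topology M q) F"
    unfolding cauchy_filter_in_def
  proof (intro conjI allI impI)
    show "F \<noteq> bot"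
      by (simp add: F_def filtermap_bot_iff)
    show "F \<le> principal (topspace (form_topology M q))"
      using v by (simp add: F_def le_principal eventually_filtermap topspace_form_topology)
    fix V assume "openin (form_topology M q) V \<and> (\<lambda>_. 0) \<in> V"
    then have "\<forall>\<^sub>F p in sequentially \<times>\<^sub>F sequentially. (\<lambda>x. v (fst p) x - v (snd p) x) \<in> V"
      using form_diff unfolding limitin_def by blast
    then show "\<forall>\<^sub>F (f, g) in F \<times>\<^sub>F F. (\<lambda>x. f x - g x) \<in> V"
      unfolding F_def prod_filtermap1 prod_filtermap2 eventually_filtermap
      by (simp add: case_prod_beta)
  qed
  then obtain l where "limitin (form_topology M q) (\<lambda>f. f) l F"
    using closed unfolding closed_form_def complete_in_def by blast
  then have lim_l: "limitin (form_topology M q) v l sequentially"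
    by (simp add: limitin_def F_def eventually_filtermap)
  note l = limitin_form_topologyD[OF lim_l]
  have eq: "AE x in M. l x = u x"
    by (rule limitin_tau_AE_unique[OF sf _ l(3) tau_u]) simp
  then show "u \<in> D"
    by (rule dom_cong[OF l(1) u])
  have "q (\<lambda>x. v n x - l x) = q (\<lambda>x. v n x - u x)" for n
    by (rule q_cong) (use eq u dom_L0[OF v] dom_L0[OF l(1)] in auto)
  with l(4) show "(\<lambda>n. Q (\<lambda>x. v n x - u x)) \<longlonglongrightarrow> 0"
    by simp
qed

text \<open>Approximate minimizers of \<open>q\<close> over the functions lying closer to the limit than some
  tail of the sequence are Cauchy by the parallelogram law, since midpoints stay in that set.\<close>

lemma lower_semicontinuous:
  assumes v: "\<And>n. v n \<in> L0 M" and u: "u \<in> L0 M" and lim: "AE x in M. (\<lambda>n. v n x) \<longlonglongrightarrow> u x"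
    and bnd: "\<And>n. q (v n) \<le> ennreal c" and c: "0 \<le> c"
  shows "q u \<le> ennreal c"
proof -
  have vD: "v n \<in> D" for n
    using v bnd[of n] by (auto simp: form_dom_def intro: le_less_trans)
  have Qv: "Q (v n) \<le> c" for n
    using bnd[of n] c by (simp add: enn2real_leI)
  \<comment> \<open>Quantifying over all bounds \<open>e\<close> replaces the supremum of the tail
    distances, which may be infinite. The condition is pointwise and convex, holds for the tail of
    \<open>v\<close>, and forces any choice of one element from each \<open>C k\<close> to converge
    wherever \<open>v\<close> does.\<close>
  define C where "C k = {w \<in> D. \<forall>x e. (\<forall>n\<ge>k. \<bar>v n x - u x\<bar> \<le> e) \<longrightarrow> \<bar>w x - u x\<bar> \<le> e}" for k :: nat
  define I where "I k = (INF w\<in>C k. Q w)" for k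
  have vC: "v n \<in> C k" if "k \<le> n" for n k
    using that vD by (auto simp: C_def)
  have C_mono: "C k \<subseteq> C j" if "j \<le> k" for j k
    using that by (auto simp: C_def)
  have I_le: "I k \<le> Q w" if "w \<in> C k" for k w
    unfolding I_def by (rule cINF_lower[OF _ that]) (auto intro!: bdd_belowI2[of _ 0])
  have I_mono: "I j \<le> I k" if "j \<le> k" for j k
    using cINF_greatest[of "C k" "I j" Q] vC[of k k] C_mono[OF that] I_le[of _ j]
    unfolding I_def[of k] by blast
  have I_c: "I k \<le> c" for k
    using I_le[OF vC[of k k]] Qv[of k] by simp
  obtain L where L: "I \<longlonglongrightarrow> L" "\<And>i. I i \<le> L"
    using incseq_convergent[of I c] I_mono I_c by (auto simp: incseq_def)
  define r where "r n = inverse (real (Suc n))" for n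
  have inv: "r \<longlonglongrightarrow> 0"
    unfolding r_def by (rule LIMSEQ_inverse_real_of_nat)
  have "0 < r k" for k
    by (simp add: r_def)
  then have "\<exists>w\<in>C k. Q w < I k + r k" for k
    using cInf_lessD[of "Q ` C k" "I k + r k"] vC[of k k] by (auto simp: I_def)
  then obtain w where w: "\<And>k. w k \<in> C k" "\<And>k. Q (w k) < I k + r k"
    by metis
  have wD: "w k \<in> D" for k
    using w(1)[of k] by (simp add: C_def)
  have w_lim: "AE x in M. (\<lambda>n. w n x) \<longlonglongrightarrow> u x"
    using lim
  proof eventually_elim
    case (elim x)
    show ?case
    proof (rule LIMSEQ_I)
      fix r :: real assume "0 < r"
      then obtain k where k: "\<And>n. k \<le> n \<Longrightarrow> \<bar>v n x - u x\<bar> \<le> r / 2"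
        using LIMSEQ_D[OF elim, of "r / 2"] by (auto intro: less_imp_le)
      have "norm (w n x - u x) < r" if "k \<le> n" for n
      proof -
        have "\<forall>m\<ge>n. \<bar>v m x - u x\<bar> \<le> r / 2"
          using k that by simp
        then have "\<bar>w n x - u x\<bar> \<le> r / 2"
          using w(1)[of n] unfolding C_def by blast
        with \<open>0 < r\<close> show ?thesis by simp
      qed
      then show "\<exists>k. \<forall>n\<ge>k. norm (w n x - u x) < r"
        by blast
    qed
  qed
  \<comment> \<open>For k = min i j the midpoint lies in \<open>C k\<close>, so the parallelogram
    law bounds the distance by 2 Q(w_i) + 2 Q(w_j) - 4 I_k. Inserting I_k >= I_i + I_j - L splits
    this bound into \<open>s i + s j\<close>.\<close>
  define s where "s i = 2 * r i + 2 * (L - I i)" for i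
  have "s \<longlonglongrightarrow> 2 * 0 + 2 * (L - L)"
    unfolding s_def by (intro tendsto_intros inv L(1))
  then have s: "s \<longlonglongrightarrow> 0"
    by simp
  have Q_le: "Q (\<lambda>x. w i x - w j x) \<le> s i + s j" for i j
  proof -
    let ?m = "\<lambda>x. 1 / 2 * (w i x + w j x)"
    define k where "k = min i j"
    have "?m \<in> C k"
      unfolding C_def
    proof (intro CollectI conjI allI impI)
      show "?m \<in> D"
        by (intro dom_scale dom_add wD)
      fix x e assume "\<forall>n\<ge>k. \<bar>v n x - u x\<bar> \<le> e"
      then have "\<forall>n\<ge>i. \<bar>v n x - u x\<bar> \<le> e" "\<forall>n\<ge>j. \<bar>v n x - u x\<bar> \<le> e"
        by (auto simp: k_def)
      then have "\<bar>w i x - u x\<bar> \<le> e" "\<bar>w j x - u x\<bar> \<le> e"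
        using w(1)[of i] w(1)[of j] unfolding C_def by blast+
      then show "\<bar>?m x - u x\<bar> \<le> e"
        unfolding abs_le_iff by (simp add: field_simps)
    qed
    then have "4 * I k \<le> Q (\<lambda>x. w i x + w j x)"
      using I_le[of ?m k] Q_scale[OF dom_add[OF wD[of i] wD[of j]], of "1 / 2"]
      by (simp add: power2_eq_square)
    moreover have "I i + I j - L \<le> I k"
      using L(2)[of i] L(2)[of j] by (cases "i \<le> j") (auto simp: k_def min_def)
    ultimately show ?thesis
      using Q_parallelogram[OF wD[of i] wD[of j]] w(2)[of i] w(2)[of j] unfolding s_def
      by (smt (verit))
  qed
  have "((\<lambda>(i, j). Q (\<lambda>x. w i x - w j x)) \<longlongrightarrow> 0) (sequentially \<times>\<^sub>F sequentially)"
  proof (rule tendsto_sandwich[OF _ _ tendsto_const])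
    have "((\<lambda>p. s (fst p) + s (snd p)) \<longlongrightarrow> 0 + 0) (sequentially \<times>\<^sub>F sequentially)"
      by (intro tendsto_add filterlim_compose[OF s] filterlim_fst filterlim_snd)
    then show "((\<lambda>p. s (fst p) + s (snd p)) \<longlongrightarrow> 0) (sequentially \<times>\<^sub>F sequentially)"
      by simp
    show "\<forall>\<^sub>F p in sequentially \<times>\<^sub>F sequentially.
        (case p of (i, j) \<Rightarrow> Q (\<lambda>x. w i x - w j x)) \<le> s (fst p) + s (snd p)"
      by (intro always_eventually allI) (simp add: case_prod_beta Q_le)
    show "\<forall>\<^sub>F p in sequentially \<times>\<^sub>F sequentially. 0 \<le> (case p of (i, j) \<Rightarrow> Q (\<lambda>x. w i x - w j x))"
      by (intro always_eventually allI) (simp add: case_prod_beta)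
  qed
  note lim_u = Cauchy_AE_limit[OF wD u w_lim this]
  have "(\<lambda>n. Q (w n)) \<longlonglongrightarrow> Q u"
    using tendsto_Q_diff[OF lim_u(1) dom_zero _ lim_u(2)] wD by simp
  moreover have "(\<lambda>n. c + r n) \<longlonglongrightarrow> c + 0"
    by (intro tendsto_intros inv)
  moreover have "Q (w n) \<le> c + r n" for n
    using w(2)[of n] I_c[of n] by linarith
  then have "\<exists>N. \<forall>n\<ge>N. Q (w n) \<le> c + r n"
    by blast
  ultimately have "Q u \<le> c + 0"
    by (rule LIMSEQ_le)
  then have "ennreal (Q u) \<le> ennreal c"
    by (intro ennreal_leI) simp
  with q_eq_Q[OF lim_u(1)] show ?thesis
    by (rule ord_eq_le_trans)
qed

end


section \<open>Energy forms\<close>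

locale energy = closed_quad_form +
  assumes mk: "markovian M q"
begin

section \<open>Contractions, lattice operations and truncations\<close>

lemma q_clamp01:
  assumes f: "f \<in> L0 M"
  shows "q (\<lambda>x. max 0 (min 1 (f x))) \<le> q f"
proof (cases "q f = \<infinity>")
  case False
  have "\<exists>C. cutoff (inverse (real (Suc n))) C \<and> (\<forall>f\<in>L0 M. q (C \<circ> f) \<le> q f)" for n
    using mk unfolding markovian_def by simp
  then obtain C where C: "\<And>n. cutoff (inverse (real (Suc n))) (C n)"
    and qC: "\<And>n. q (C n \<circ> f) \<le> q f"
    using f by metis
  \<comment> \<open>Beyond an endpoint of [0, 1], monotonicity keeps \<open>C n\<close> on the far
    side of the endpoint value and the range condition keeps it within the allowed
    overshoot.\<close>
  have close: "\<bar>C n y - max 0 (min 1 y)\<bar> \<le> inverse (real (Suc n))" for n y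
  proof -
    have mono: "\<And>a b. a \<le> b \<Longrightarrow> C n a \<le> C n b"
      and id: "\<And>y. 0 \<le> y \<Longrightarrow> y \<le> 1 \<Longrightarrow> C n y = y"
      using C[of n] unfolding cutoff_def mono_def by auto
    have "C n y \<in> {- inverse (real (Suc n))..1 + inverse (real (Suc n))}"
      using C[of n] unfolding cutoff_def by blast
    then have range: "- inverse (real (Suc n)) \<le> C n y" "C n y \<le> 1 + inverse (real (Suc n))"
      by simp_all
    have pos: "0 < inverse (real (Suc n))" by simp
    consider "y < 0" | "0 \<le> y" "y \<le> 1" | "1 < y" by linarith
    then show ?thesis
    proof cases
      case 1
      then show ?thesis using mono[of y 0] id[of 0] range pos by (simp add: abs_le_iff)
    next
      case 2
      then show ?thesis using id[of y] pos by (simp add: min_def)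
    next
      case 3
      then show ?thesis using mono[of 1 y] id[of 1] range pos by (simp add: abs_le_iff)
    qed
  qed
  have lim: "(\<lambda>n. (C n \<circ> f) x) \<longlonglongrightarrow> max 0 (min 1 (f x))" for x
    unfolding o_def
    by (rule LIM_zero_cancel, rule Lim_null_comparison[OF _ LIMSEQ_inverse_real_of_nat])
      (auto intro!: always_eventually simp only: real_norm_def close)
  have "q (\<lambda>x. max 0 (min 1 (f x))) \<le> ennreal (Q f)"
  proof (rule lower_semicontinuous[where v = "\<lambda>n. C n \<circ> f"])
    show "C n \<circ> f \<in> L0 M" for n
      using C[of n] by (intro measurable_comp[OF f] borel_measurable_mono) (simp add: cutoff_def)
    show "(\<lambda>x. max 0 (min 1 (f x))) \<in> L0 M"
      using f by measurable
    show "q (C n \<circ> f) \<le> ennreal (Q f)" for n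
      using qC[of n] False by (simp add: less_top)
  qed (use lim in auto)
  then show ?thesis
    using False by (simp add: less_top)
qed simp

lemma q_clamp:
  assumes f: "f \<in> L0 M" and c: "0 < c"
  shows "q (\<lambda>x. max 0 (min c (f x))) \<le> q f"
proof -
  note f[measurable]
  let ?u = "\<lambda>x. (1 / c) * f x"
  have eq: "(\<lambda>x. max 0 (min c (f x))) = (\<lambda>x. c * max 0 (min 1 (?u x)))"
  proof
    fix x
    show "max 0 (min c (f x)) = c * max 0 (min 1 (?u x))"
      using c by (cases "f x \<le> 0"; cases "f x \<le> c") (auto simp: min_def max_def field_simps)
  qed
  have "q (\<lambda>x. max 0 (min c (f x))) = ennreal (c\<^sup>2) * q (\<lambda>x. max 0 (min 1 (?u x)))"
    unfolding eq by (rule q_scale) measurable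
  also have "\<dots> \<le> ennreal (c\<^sup>2) * q ?u"
    by (intro mult_left_mono q_clamp01) auto
  also have "\<dots> = q (\<lambda>x. c * ?u x)"
    by (rule q_scale[symmetric]) measurable
  also have "\<dots> = q f"
    using c by simp
  finally show ?thesis .
qed

lemma q_pos_part:
  assumes f: "f \<in> L0 M"
  shows "q (\<lambda>x. max 0 (f x)) \<le> q f"
proof (cases "q f = \<infinity>")
  case False
  note f[measurable]
  have "q (\<lambda>x. max 0 (f x)) \<le> ennreal (Q f)"
  proof (rule lower_semicontinuous)
    show "q (\<lambda>x. max 0 (min (real (Suc n)) (f x))) \<le> ennreal (Q f)" for n
      using q_clamp[OF f, of "real (Suc n)"] False by (simp add: less_top)
    have "(\<lambda>n. max 0 (min (real (Suc n)) (f x))) \<longlonglongrightarrow> max 0 (f x)" for x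
    proof (rule tendsto_eventually)
      show "\<forall>\<^sub>F n in sequentially. max 0 (min (real (Suc n)) (f x)) = max 0 (f x)"
        using eventually_ge_at_top[of "nat \<lceil>f x\<rceil>"]
      proof eventually_elim
        case (elim n)
        then have "f x \<le> real (Suc n)" by linarith
        then show ?case by (simp add: min_absorb2)
      qed
    qed
    then show "AE x in M. (\<lambda>n. max 0 (min (real (Suc n)) (f x))) \<longlonglongrightarrow> max 0 (f x)"
      by simp
  qed auto
  then show ?thesis
    using False by (simp add: less_top)
qed simp

lemma dom_of_q_le: "f \<in> D \<Longrightarrow> g \<in> L0 M \<Longrightarrow> q g \<le> q f \<Longrightarrow> g \<in> D"
  by (auto simp: form_dom_def intro: le_less_trans)

lemma Q_le_of_q_le: "f \<in> D \<Longrightarrow> q g \<le> q f \<Longrightarrow> Q g \<le> Q f"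
  by (auto simp: form_dom_def intro: enn2real_mono)

lemma dom_pos_part: "f \<in> D \<Longrightarrow> (\<lambda>x. max 0 (f x)) \<in> D"
  by (rule dom_of_q_le[OF _ _ q_pos_part]) (auto dest: dom_L0)

lemma dom_clamp: "f \<in> D \<Longrightarrow> 0 < c \<Longrightarrow> (\<lambda>x. max 0 (min c (f x))) \<in> D"
  by (rule dom_of_q_le[OF _ _ q_clamp]) (auto dest: dom_L0)

lemma dom_neg_part: "f \<in> D \<Longrightarrow> (\<lambda>x. min 0 (f x)) \<in> D"
  using dom_diff[OF _ dom_pos_part, of f f]
  by (rule back_subst[of "\<lambda>u. u \<in> D"]) (auto simp: min_def max_def)

text \<open>Scaling the negative part by t > 0 leaves the positive part unchanged, so the latter
  minimizes the energy in this direction by \<open>q_pos_part\<close>.\<close>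

lemma B_pos_neg:
  assumes f: "f \<in> D"
  shows "0 \<le> B (\<lambda>x. max 0 (f x)) (\<lambda>x. min 0 (f x))"
proof (rule B_nonneg_of_minimal[OF dom_pos_part[OF f] dom_neg_part[OF f]])
  fix t :: real assume t: "0 < t"
  let ?g = "\<lambda>x. max 0 (f x) + t * min 0 (f x)"
  have g: "?g \<in> D"
    by (intro dom_add dom_scale dom_pos_part dom_neg_part f)
  have "(\<lambda>x. max 0 (f x)) = (\<lambda>x. max 0 (?g x))"
  proof
    fix x show "max 0 (f x) = max 0 (?g x)"
      using t by (cases "0 \<le> f x") (auto simp: max_def min_def mult_le_0_iff zero_le_mult_iff)
  qed
  then show "Q (\<lambda>x. max 0 (f x)) \<le> Q ?g"
    using Q_le_of_q_le[OF g q_pos_part[OF dom_L0[OF g]]] by simp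
qed

lemma dom_abs: "f \<in> D \<Longrightarrow> (\<lambda>x. \<bar>f x\<bar>) \<in> D"
  using dom_diff[OF dom_pos_part dom_neg_part, of f f]
  by (rule back_subst[of "\<lambda>u. u \<in> D"]) (auto simp: min_def max_def)

lemma Q_abs:
  assumes f: "f \<in> D"
  shows "Q (\<lambda>x. \<bar>f x\<bar>) \<le> Q f"
proof -
  let ?p = "\<lambda>x. max 0 (f x)" and ?n = "\<lambda>x. min 0 (f x)"
  have "(\<lambda>x. \<bar>f x\<bar>) = (\<lambda>x. ?p x - ?n x)" "f = (\<lambda>x. ?p x + ?n x)"
    by (auto simp: min_def max_def)
  then have "Q (\<lambda>x. \<bar>f x\<bar>) = Q ?p - 2 * B ?p ?n + Q ?n" "Q f = Q ?p + 2 * B ?p ?n + Q ?n"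
    using Q_diff[OF dom_pos_part[OF f] dom_neg_part[OF f]] Q_add[OF dom_pos_part[OF f] dom_neg_part[OF f]]
    by metis+
  with B_pos_neg[OF f] show ?thesis
    by simp
qed

text \<open>The maximum is half of (a + b) + |a - b|. The parallelogram law is used before and after
  replacing |a - b| by a - b, and one square is dropped.\<close>

lemma
  assumes a: "a \<in> D" and b: "b \<in> D"
  shows dom_max: "(\<lambda>x. max (a x) (b x)) \<in> D"
    and Q_max_le: "Q (\<lambda>x. max (a x) (b x)) \<le> Q a + Q b"
proof -
  let ?s = "\<lambda>x. a x + b x" and ?d = "\<lambda>x. \<bar>a x - b x\<bar>"
  have s: "?s \<in> D" and d: "?d \<in> D"
    using dom_add[OF a b] dom_abs[OF dom_diff[OF a b]] .
  have eq: "(\<lambda>x. max (a x) (b x)) = (\<lambda>x. 1 / 2 * (?s x + ?d x))"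
    by (auto simp: max_def field_simps)
  show "(\<lambda>x. max (a x) (b x)) \<in> D"
    unfolding eq by (intro dom_scale dom_add[OF s d])
  have "4 * Q (\<lambda>x. max (a x) (b x)) = Q (\<lambda>x. ?s x + ?d x)"
    unfolding eq Q_scale[OF dom_add[OF s d]] by (simp add: power2_eq_square)
  also have "\<dots> \<le> 2 * Q ?s + 2 * Q ?d"
    using Q_parallelogram[OF s d] enn2real_nonneg[of "q (\<lambda>x. ?s x - ?d x)"] by linarith
  also have "\<dots> \<le> 2 * Q ?s + 2 * Q (\<lambda>x. a x - b x)"
    using Q_abs[OF dom_diff[OF a b]] by simp
  also have "\<dots> = 4 * (Q a + Q b)"
    using Q_parallelogram[OF a b] by simp
  finally show "Q (\<lambda>x. max (a x) (b x)) \<le> Q a + Q b"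
    by simp
qed

lemma dom_min:
  assumes "a \<in> D" "b \<in> D"
  shows "(\<lambda>x. min (a x) (b x)) \<in> D"
  using dom_diff[OF dom_add[OF assms] dom_max[OF assms]]
  by (rule back_subst[of "\<lambda>u. u \<in> D"]) (auto simp: min_def max_def)

text \<open>Split \<open>e\<close> into min(e, h) and (e - h)^+. Since min(e, h) = h + min(0, e -
  h), the cross term is a sum of two nonnegative ones: one by superharmonicity, one by
  \<open>B_pos_neg\<close>.\<close>

lemma Q_min_superharmonic:
  assumes h: "superharmonic M q h" and e: "e \<in> D"
  shows "Q (\<lambda>x. min (e x) (h x)) \<le> Q e"
proof -
  have hD: "h \<in> D"
    using h by (simp add: superharmonic_def)
  let ?u = "\<lambda>x. e x - h x"
  let ?p = "\<lambda>x. max 0 (?u x)" and ?n = "\<lambda>x. min 0 (?u x)"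
  have u: "?u \<in> D" by (intro dom_diff e hD)
  note p = dom_pos_part[OF u] and n = dom_neg_part[OF u]
  have eq: "(\<lambda>x. min (e x) (h x)) = (\<lambda>x. h x + ?n x)" "e = (\<lambda>x. min (e x) (h x) + ?p x)"
    by (auto simp: min_def max_def)
  have "0 \<le> B h ?p"
    using h p unfolding superharmonic_def by simp
  moreover have "0 \<le> B ?n ?p"
    using B_pos_neg[OF u] B_commute[OF dom_L0[OF p] dom_L0[OF n]] by simp
  ultimately have "0 \<le> B (\<lambda>x. min (e x) (h x)) ?p"
    unfolding eq(1) B_add_left[OF hD n p] by simp
  moreover have "Q e = Q (\<lambda>x. min (e x) (h x)) + 2 * B (\<lambda>x. min (e x) (h x)) ?p + Q ?p"
    using Q_add[OF dom_min[OF e hD] p] eq(2) by simp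
  ultimately show ?thesis
    using enn2real_nonneg[of "q ?p"] by linarith
qed

lemma Q_diff_truncation:
  assumes f: "f \<in> D" and pos: "\<And>x. 0 \<le> f x" and c: "0 < c"
  shows "Q (\<lambda>x. f x - min c (f x)) \<le> Q f - Q (\<lambda>x. min c (f x))"
proof -
  let ?a = "\<lambda>x. min c (f x)" and ?b = "\<lambda>x. f x - min c (f x)"
  have trunc: "(\<lambda>x. min c (g x)) \<in> D" "Q (\<lambda>x. min c (g x)) \<le> Q g"
    if "g \<in> D" "\<And>x. 0 \<le> g x" for g
  proof -
    have "(\<lambda>x. min c (g x)) = (\<lambda>x. max 0 (min c (g x)))"
      using that(2) c by (auto simp: max_def)
    then show "(\<lambda>x. min c (g x)) \<in> D" "Q (\<lambda>x. min c (g x)) \<le> Q g"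
      using dom_clamp[OF that(1) c] Q_le_of_q_le[OF that(1) q_clamp[OF dom_L0[OF that(1)] c]]
      by simp_all
  qed
  note a = trunc(1)[OF f pos]
  have b: "?b \<in> D" by (rule dom_diff[OF f a])
  have "0 \<le> B ?a ?b"
  proof (rule B_nonneg_of_minimal[OF a b])
    fix t :: real assume t: "0 < t"
    let ?g = "\<lambda>x. ?a x + t * ?b x"
    have g: "?g \<in> D" by (intro dom_add dom_scale a b)
    have "?a = (\<lambda>x. min c (?g x))"
      using t c by (auto simp: min_def)
    moreover have "0 \<le> ?g x" for x
      using pos[of x] t c by (auto simp: min_def)
    ultimately show "Q ?a \<le> Q ?g"
      using trunc(2)[OF g] by simp
  qed
  then show ?thesis
    using Q_add[OF a b] by simp
qed

lemma dom_truncation: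
  "f \<in> D \<Longrightarrow> (\<And>x. 0 \<le> f x) \<Longrightarrow> 0 < c \<Longrightarrow> (\<lambda>x. min c (f x)) \<in> D"
  using dom_clamp[of f c] by (simp add: max_absorb2)

text \<open>By the previous estimate the energies of the truncations decrease and control the distances
  between them, so that the truncations are Cauchy.\<close>

lemma Q_truncation_tendsto_0:
  assumes f: "f \<in> D" and pos: "\<And>x. 0 \<le> f x"
  shows "(\<lambda>n. Q (\<lambda>x. min (inverse (real (Suc n))) (f x))) \<longlonglongrightarrow> 0"
proof -
  define a where "a n = (\<lambda>x. min (inverse (real (Suc n))) (f x))" for n
  have aD: "a n \<in> D" for n
    unfolding a_def by (rule dom_truncation[OF f pos]) simp
  have a_pos: "0 \<le> a n x" for n x
    using pos by (simp add: a_def)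
  have diff: "Q (\<lambda>x. a n x - a m x) \<le> Q (a n) - Q (a m)" if "n \<le> m" for n m
  proof -
    have "a m = (\<lambda>x. min (inverse (real (Suc m))) (a n x))"
      using that by (auto simp: a_def min.assoc[symmetric] min_absorb1 le_imp_inverse_le)
    then show ?thesis
      using Q_diff_truncation[OF aD a_pos, of "inverse (real (Suc m))" n] by simp
  qed
  then have "decseq (\<lambda>n. Q (a n))"
    unfolding decseq_def by (meson diff_ge_0_iff_ge enn2real_nonneg order_trans)
  then obtain r where r: "(\<lambda>n. Q (a n)) \<longlonglongrightarrow> r" "\<And>n. r \<le> Q (a n)"
    using decseq_convergent[of "\<lambda>n. Q (a n)" 0] by auto
  have a_lim: "(\<lambda>m. a m x) \<longlonglongrightarrow> 0" for x
  proof (rule tendsto_sandwich[OF _ _ tendsto_const LIMSEQ_inverse_real_of_nat])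
    show "\<forall>\<^sub>F n in sequentially. 0 \<le> a n x"
      using a_pos by simp
    show "\<forall>\<^sub>F n in sequentially. a n x \<le> inverse (real (Suc n))"
      by (simp add: a_def)
  qed
  \<comment> \<open>As k grows, \<open>a n - a (n + k)\<close> tends to \<open>a n\<close>
    pointwise, with energies at most \<open>Q (a n) - r\<close>; lower semicontinuity then leaves no
    room for r > 0.\<close>
  have "q (a n) \<le> ennreal (Q (a n) - r)" for n
  proof (rule lower_semicontinuous)
    show "(\<lambda>x. a n x - a (n + k) x) \<in> L0 M" for k
      by (rule dom_L0[OF dom_diff[OF aD aD]])
    have "(\<lambda>k. a n x - a (k + n) x) \<longlonglongrightarrow> a n x - 0" for x
      by (intro tendsto_intros LIMSEQ_ignore_initial_segment a_lim)
    then show "AE x in M. (\<lambda>k. a n x - a (n + k) x) \<longlonglongrightarrow> a n x"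
      by (simp add: add.commute)
    fix k
    have "Q (\<lambda>x. a n x - a (n + k) x) \<le> Q (a n) - r"
      using diff[of n "n + k"] r(2)[of "n + k"] by simp
    from ennreal_leI[OF this] show "q (\<lambda>x. a n x - a (n + k) x) \<le> ennreal (Q (a n) - r)"
      by (rule ord_eq_le_trans[OF q_eq_Q[OF dom_diff[OF aD aD]]])
  qed (use dom_L0[OF aD] r(2)[of n] in auto)
  then have "Q (a n) \<le> Q (a n) - r" for n
    using r(2)[of n] by (simp add: enn2real_leI)
  then have "r \<le> 0" by auto
  moreover have "0 \<le> r"
    by (rule LIMSEQ_le_const[OF r(1)]) auto
  ultimately show ?thesis
    using r(1) by (simp add: a_def)
qed


text \<open>Small energy alone gives no pointwise control. Energies of maxima are subadditive,
  however, so the tail suprema \<open>S m\<close> have energy tending to 0, and their decreasing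
  limit lies in the kernel. The common bound \<open>k\<close> keeps the suprema finite.\<close>

lemma tendsto_0_of_summable_Q:
  assumes tr: "transient M q" and e: "\<And>n. e n \<in> D"
    and pos: "\<And>n x. 0 \<le> e n x" and bnd: "\<And>n x. e n x \<le> k x"
    and Qe: "\<And>n. Q (e n) \<le> (1 / 2) ^ n"
  shows "AE x in M. (\<lambda>n. e n x) \<longlonglongrightarrow> 0"
proof -
  define T where "T m = rec_nat (e m) (\<lambda>n w x. max (w x) (e (m + Suc n) x))" for m
  have T_0: "T m 0 = e m" and T_Suc: "T m (Suc n) = (\<lambda>x. max (T m n x) (e (m + Suc n) x))" for m n
    by (simp_all add: T_def)
  \<comment> \<open>\<open>T m n\<close> is the maximum of e_m, ..., e_(m+n), and the bound is the
    geometric sum of 2^-j over the same indices.\<close>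
  have T: "T m n \<in> D \<and> Q (T m n) \<le> 2 * (1 / 2) ^ m - (1 / 2) ^ (m + n)" for m n
  proof (induction n)
    case 0
    show ?case using e[of m] Qe[of m] by (simp add: T_0)
  next
    case (Suc n)
    then show ?case
      using dom_max[of "T m n" "e (m + Suc n)"] Q_max_le[of "T m n" "e (m + Suc n)"]
        e[of "m + Suc n"] Qe[of "m + Suc n"] by (simp add: T_Suc)
  qed
  have T_ge: "e (m + n) x \<le> T m n x" for m n x
    by (cases n) (simp_all add: T_0 T_Suc)
  have T_le: "T m n x \<le> k x" for m n x
    by (induction n) (auto simp: T_0 T_Suc bnd)
  have T_inc: "incseq (\<lambda>n. T m n x)" for m x
    by (rule incseq_SucI) (simp add: T_Suc)
  have T_shift: "T (Suc m) n x \<le> T m (Suc n) x" for m n x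
    by (induction n) (auto simp: T_0 T_Suc max.coboundedI1 max.coboundedI2)
  define S where "S m x = (SUP n. T m n x)" for m x
  have bdd: "bdd_above (range (\<lambda>n. T m n x))" for m x
    unfolding bdd_above_def using T_le by blast
  have S_lim: "(\<lambda>n. T m n x) \<longlonglongrightarrow> S m x" for m x
    unfolding S_def by (rule LIMSEQ_incseq_SUP[OF bdd T_inc])
  have T_le_S: "T m n x \<le> S m x" for m n x
    unfolding S_def by (rule cSUP_upper[OF _ bdd]) simp
  have S_ge: "e m x \<le> S m x" for m x
    using T_le_S[of m 0 x] by (simp add: T_0)
  have S_L0: "S m \<in> L0 M" for m
    by (rule borel_measurable_LIMSEQ_real[OF S_lim]) (use T dom_L0 in auto)
  have qS: "q (S m) \<le> ennreal (2 * (1 / 2) ^ m)" for m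
  proof (rule lower_semicontinuous[where v = "T m"])
    fix n
    have "Q (T m n) \<le> 2 * (1 / 2) ^ m"
      using T[of m n] zero_le_power[of "1 / 2 :: real" "m + n"] by linarith
    then show "q (T m n) \<le> ennreal (2 * (1 / 2) ^ m)"
      using ord_eq_le_trans[OF q_eq_Q ennreal_leI] T by blast
  qed (use T dom_L0 S_L0 S_lim in auto)
  have S_dec: "S (Suc m) x \<le> S m x" for m x
    by (rule LIMSEQ_le_const2[OF S_lim]) (use T_shift T_le_S order_trans in blast)
  have "\<exists>l. (\<lambda>m. S m x) \<longlonglongrightarrow> l" for x
    using decseq_convergent[of "\<lambda>m. S m x" 0] decseq_SucI[of "\<lambda>m. S m x"] S_dec
      order_trans[OF pos S_ge] by metis
  then obtain L where L: "\<And>x. (\<lambda>m. S m x) \<longlonglongrightarrow> L x"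
    by metis
  have L_L0: "L \<in> L0 M"
    by (rule borel_measurable_LIMSEQ_real[OF L S_L0])
  have qL: "q L \<le> ennreal (2 * (1 / 2) ^ m)" for m
  proof (rule lower_semicontinuous[where v = "\<lambda>n. S (n + m)"])
    fix n
    have "(1 / 2 :: real) ^ (n + m) \<le> (1 / 2) ^ m"
      by (intro power_decreasing) auto
    then show "q (S (n + m)) \<le> ennreal (2 * (1 / 2) ^ m)"
      by (intro order_trans[OF qS ennreal_leI]) simp
  qed (use S_L0 L_L0 LIMSEQ_ignore_initial_segment[OF L] in auto)
  have "(\<lambda>m. ennreal (2 * (1 / 2) ^ m)) \<longlonglongrightarrow> ennreal (2 * 0)"
    by (intro tendsto_intros LIMSEQ_power_zero) auto
  then have "q L \<le> ennreal (2 * 0)"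
    by (rule LIMSEQ_le_const) (use qL in blast)
  then have "L \<in> form_ker M q"
    using L_L0 by (simp add: form_ker_def)
  then have "AE x in M. L x = 0"
    using tr by (simp add: transient_def)
  then show ?thesis
  proof eventually_elim
    case (elim x)
    show ?case
      by (rule tendsto_sandwich[OF _ _ tendsto_const]) (use L[of x] elim pos S_ge in auto)
  qed
qed

section \<open>The special nest of level sets\<close>

definition level_nest :: "'a set set" where
  "level_nest = {{x \<in> space M. c < f x} | f c. f \<in> D \<and> 0 < c}"

lemma level_nest_domI:
  assumes "u \<in> D" "f \<in> D" "0 < c" "AE x in M. u x \<noteq> 0 \<longrightarrow> c < f x"
  shows "u \<in> nest_dom M q level_nest"
  unfolding nest_dom_def
proof (intro CollectI conjI bexI)
  show "AE x in M. u x * indicator (space M - {x \<in> space M. c < f x}) x = 0"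
    using assms(4) by eventually_elim (auto simp: indicator_def)
  show "{x \<in> space M. c < f x} \<in> level_nest"
    using assms(2,3) unfolding level_nest_def by blast
qed fact

lemma level_nest_domE:
  assumes "u \<in> nest_dom M q level_nest"
  obtains f c where "u \<in> D" "f \<in> D" "0 < c" "AE x in M. u x \<noteq> 0 \<longrightarrow> c < f x"
proof -
  from assms obtain f c where "u \<in> D" "f \<in> D" "0 < c"
    and "AE x in M. u x * indicator (space M - {x \<in> space M. c < f x}) x = 0"
    unfolding nest_dom_def level_nest_def by blast
  moreover from this(4) have "AE x in M. u x \<noteq> 0 \<longrightarrow> c < f x"
    using AE_space by eventually_elim (auto simp: indicator_def split: if_splits)
  ultimately show thesis
    using that by blast
qed

lemma linear_subspace_level_nest: "linear_subspace (nest_dom M q level_nest)"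
  unfolding linear_subspace_def
proof (intro conjI ballI allI)
  show "(\<lambda>_. 0) \<in> nest_dom M q level_nest"
    by (rule level_nest_domI[OF dom_zero dom_zero zero_less_one]) simp
next
  fix u v assume "u \<in> nest_dom M q level_nest" and v': "v \<in> nest_dom M q level_nest"
  then obtain f c where u: "u \<in> D" "f \<in> D" "0 < c" "AE x in M. u x \<noteq> 0 \<longrightarrow> c < f x"
    by (elim level_nest_domE)
  from v' obtain g d where v: "v \<in> D" "g \<in> D" "0 < d" "AE x in M. v x \<noteq> 0 \<longrightarrow> d < g x"
    by (elim level_nest_domE)
  \<comment> \<open>The union of two level sets lies in a level set of the maximum, at the smaller
    height.\<close>
  show "(\<lambda>x. u x + v x) \<in> nest_dom M q level_nest"
  proof (rule level_nest_domI[OF dom_add[OF u(1) v(1)] dom_max[OF u(2) v(2)]])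
    show "0 < min c d" using u v by simp
    show "AE x in M. u x + v x \<noteq> 0 \<longrightarrow> min c d < max (f x) (g x)"
      using u(4) v(4)
    proof eventually_elim
      case (elim x)
      then show ?case by (cases "u x = 0"; cases "v x = 0") auto
    qed
  qed
next
  fix c u assume "u \<in> nest_dom M q level_nest"
  then obtain f d where u: "u \<in> D" "f \<in> D" "0 < d" "AE x in M. u x \<noteq> 0 \<longrightarrow> d < f x"
    by (rule level_nest_domE)
  show "(\<lambda>x. c * u x) \<in> nest_dom M q level_nest"
    by (rule level_nest_domI[OF dom_scale[OF u(1)] u(2,3)]) (use u(4) in auto)
qed

text \<open>Subtracting the truncations of both parts of \<open>f\<close> at height 1 / (n + 1)
  kills \<open>f\<close> where |f| is at most that height, so what remains is supported in a level
  set of |f|. The error is the difference of two truncations of vanishing energy.\<close>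

lemma level_nest_dense: "D \<subseteq> form_topology M q closure_of nest_dom M q level_nest"
proof
  fix f assume f: "f \<in> D"
  let ?p = "\<lambda>x. max 0 (f x)" and ?m = "\<lambda>x. max 0 (- f x)"
  have mf: "(\<lambda>x. - f x) \<in> D"
    using dom_scale[OF f, of "- 1"] by simp
  note p = dom_pos_part[OF f] and m = dom_pos_part[OF mf]
  define a where "a n = (\<lambda>x. min (inverse (real (Suc n))) (?p x))" for n
  define b where "b n = (\<lambda>x. min (inverse (real (Suc n))) (?m x))" for n
  have aD: "a n \<in> D" and bD: "b n \<in> D" for n
    unfolding a_def b_def by (intro dom_truncation p m; simp)+
  define u where "u n = (\<lambda>x. f x - (a n x - b n x))" for n
  have uD: "u n \<in> D" for n
    unfolding u_def by (intro dom_diff f aD bD)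
  have u_nest: "u n \<in> nest_dom M q level_nest" for n
  proof (rule level_nest_domI[OF uD dom_abs[OF f], of "inverse (real (Suc n))"])
    have "\<bar>f x\<bar> \<le> inverse (real (Suc n)) \<Longrightarrow> u n x = 0" for x
      by (cases "0 \<le> f x") (simp_all add: u_def a_def b_def max_def min_def)
    then show "AE x in M. u n x \<noteq> 0 \<longrightarrow> inverse (real (Suc n)) < \<bar>f x\<bar>"
      by (intro AE_I2) (metis not_le)
  qed simp
  have u_lim: "(\<lambda>n. u n x) \<longlonglongrightarrow> f x" for x
  proof (rule LIM_zero_cancel, rule Lim_null_comparison[OF _ LIMSEQ_inverse_real_of_nat])
    have "\<bar>u n x - f x\<bar> \<le> inverse (real (Suc n))" for n
      using positive_imp_inverse_positive[of "real (Suc n)"]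
      unfolding u_def a_def b_def max_def min_def by (auto simp del: of_nat_Suc)
    then show "\<forall>\<^sub>F n in sequentially. norm (u n x - f x) \<le> inverse (real (Suc n))"
      by simp
  qed
  have "limitin (form_topology M q) u f sequentially"
  proof (rule limitin_form_topologyI[OF f])
    show "limitin (tau M) u f sequentially"
      using uD f dom_L0 u_lim by (intro limitin_tau_AE) auto
    have "Q (\<lambda>x. u n x - f x) \<le> 2 * Q (a n) + 2 * Q (b n)" for n
    proof -
      have "Q (\<lambda>x. u n x - f x) = Q (\<lambda>x. b n x - a n x)"
        by (simp add: u_def)
      then show ?thesis
        using Q_parallelogram[OF bD[of n] aD[of n]] enn2real_nonneg[of "q (\<lambda>x. b n x + a n x)"]
        by linarith
    qed
    then have "\<forall>\<^sub>F n in sequentially. norm (Q (\<lambda>x. u n x - f x)) \<le> 2 * Q (a n) + 2 * Q (b n)"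
      by simp
    moreover have "(\<lambda>n. 2 * Q (a n) + 2 * Q (b n)) \<longlonglongrightarrow> 2 * 0 + 2 * 0"
      unfolding a_def b_def by (intro tendsto_intros Q_truncation_tendsto_0 p m) auto
    then have "(\<lambda>n. 2 * Q (a n) + 2 * Q (b n)) \<longlonglongrightarrow> 0"
      by simp
    ultimately show "(\<lambda>n. Q (\<lambda>x. u n x - f x)) \<longlonglongrightarrow> 0"
      by (rule Lim_null_comparison)
  qed (use uD in auto)
  then have "\<exists>n. u n \<in> V" if "openin (form_topology M q) V" "f \<in> V" for V
    using that unfolding limitin_def by (meson eventually_sequentially order_refl)
  then show "f \<in> form_topology M q closure_of nest_dom M q level_nest"
    using f u_nest unfolding in_closure_of topspace_form_topology by blast
qed

lemma special_level_nest: "special_nest M q level_nest"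
  unfolding special_nest_def nest_def
proof (intro conjI ballI)
  show "level_nest \<subseteq> sets M"
    unfolding level_nest_def using dom_L0 by auto
  show "linear_subspace (nest_dom M q level_nest)"
    by (rule linear_subspace_level_nest)
  show "form_topology M q closure_of nest_dom M q level_nest = D"
    using level_nest_dense closure_of_subset_topspace[of "form_topology M q"]
    unfolding topspace_form_topology by blast
next
  fix N assume "N \<in> level_nest"
  then obtain f c where N: "N = {x \<in> space M. c < f x}" and f: "f \<in> D" and c: "0 < c"
    unfolding level_nest_def by blast
  note p = dom_pos_part[OF f]
  \<comment> \<open>This is (2 / c) (f - c / 2)^+. The height is halved so that \<open>?g\<close>
    reaches 1 on {f > c} and still vanishes off the larger level set {f > c / 2}.\<close>
  let ?g = "\<lambda>x. 2 / c * (max 0 (f x) - min (c / 2) (max 0 (f x)))"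
  show "\<exists>g\<in>nest_dom M q level_nest. AE x in M. indicator N x \<le> g x"
  proof (intro bexI AE_I2)
    show "?g \<in> nest_dom M q level_nest"
    proof (rule level_nest_domI[OF _ f])
      show "?g \<in> D"
        using c by (intro dom_scale dom_diff p dom_truncation) auto
      show "AE x in M. ?g x \<noteq> 0 \<longrightarrow> c / 2 < f x"
        using c by (intro AE_I2) (auto simp: min_def max_def split: if_splits)
    qed (use c in simp)
    show "indicator N x \<le> ?g x" for x
      using c by (cases "c < f x") (auto simp: N indicator_def field_simps)
  qed
qed

end

section \<open>Capacities along a nest\<close>

lemma cap_nest_eq_0:
  assumes qf: "quadratic_form M E" and \<N>: "nest M E \<N>" and h: "h \<in> form_dom M E"
  shows "(INF N\<in>\<N>. cap M E h (space M - N)) = 0"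
proof -
  interpret quad_form M E by standard fact
  have le: "(INF N\<in>\<N>. cap M E h (space M - N)) \<le> 0 + ennreal \<epsilon>" if "0 < \<epsilon>" for \<epsilon>
  proof -
    define V where "V = {g \<in> D. sqrt (Q (\<lambda>x. g x - h x)) < sqrt \<epsilon>}"
    have "openin (form_topology M E) V"
      unfolding V_def using that by (intro openin_form_topology h) simp
    moreover have "h \<in> V"
      using h that by (simp add: V_def q_zero)
    moreover have "h \<in> form_topology M E closure_of nest_dom M E \<N>"
      using \<N> h by (simp add: nest_def)
    ultimately obtain f where "f \<in> nest_dom M E \<N>" "f \<in> V"
      unfolding in_closure_of by blast
    then have f: "f \<in> nest_dom M E \<N>" "sqrt (Q (\<lambda>x. f x - h x)) < sqrt \<epsilon>"
      by (simp_all add: V_def)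
    then obtain N where N: "N \<in> \<N>" "AE x in M. f x * indicator (space M - N) x = 0" and fD: "f \<in> D"
      unfolding nest_dom_def by blast
    have "cap M E h (space M - N) \<le> E (\<lambda>x. h x - f x)"
      unfolding cap_def
    proof (intro Inf_lower CollectI exI conjI)
      show "(\<lambda>x. h x - f x) \<in> L0 M"
        by (intro dom_L0 dom_diff h fD)
      show "AE x in M. h x * indicator (space M - N) x \<le> (h x - f x) * indicator (space M - N) x"
        using N(2) by eventually_elim (auto simp: left_diff_distrib)
    qed simp
    also have "\<dots> = E (\<lambda>x. f x - h x)"
      by (intro q_diff_commute dom_L0 h fD)
    also have "\<dots> = ennreal (Q (\<lambda>x. f x - h x))"
      by (intro q_eq_Q dom_diff h fD)
    also have "\<dots> \<le> ennreal \<epsilon>"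
      using f(2) by (intro ennreal_leI) simp
    finally show ?thesis
      using N(1) by (auto intro: INF_lower2)
  qed
  have "(INF N\<in>\<N>. cap M E h (space M - N)) \<le> 0"
    by (rule ennreal_le_epsilon[OF le])
  then show ?thesis by simp
qed

lemma cap_cong: "(\<And>f. f \<in> L0 M \<Longrightarrow> E f = E' f) \<Longrightarrow> cap M E h U = cap M E' h U"
  unfolding cap_def by (intro arg_cong[where f = Inf]) (metis (mono_tags, lifting))


section \<open>Silverstein extensions\<close>

locale transient_silverstein_extension =
  fixes M :: "'a measure" and E E' :: "('a \<Rightarrow> real) \<Rightarrow> ennreal" and h :: "'a \<Rightarrow> real"
  assumes sf: "semi_finite M" and E: "energy_form M E" and ext: "silverstein_extension M E E'"
    and tr: "transient M E'" and h: "superharmonic M E' h" and h_pos: "AE x in M. 0 < h x"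
begin

lemma E': "energy_form M E'"
  using ext by (simp add: silverstein_extension_def)

sublocale E: energy M E
  by standard (use sf E in \<open>simp_all add: energy_form_def\<close>)

sublocale E': energy M E'
  by standard (use sf E' in \<open>simp_all add: energy_form_def\<close>)

lemma dom_subset: "f \<in> E.D \<Longrightarrow> f \<in> E'.D"
  and E'_eq_E: "f \<in> E.D \<Longrightarrow> E' f = E f"
  using ext by (auto simp: silverstein_extension_def form_extension_def)

lemma h_dom: "h \<in> E'.D"
  using h by (simp add: superharmonic_def)

lemma product_dom: "f \<in> E.D \<Longrightarrow> f \<in> Linfty M \<Longrightarrow> g \<in> E'.D \<Longrightarrow> g \<in> Linfty M \<Longrightarrow> (\<lambda>x. f x * g x) \<in> E.D"
  using ext by (simp add: silverstein_extension_def)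

text \<open>The energies may be measured by \<open>E'\<close>, which agrees with \<open>E\<close> on
  the approximants, while lower semicontinuity is applied to \<open>E\<close>: this is what carries
  the limit into the smaller domain.\<close>

lemma dom_of_approximation:
  assumes v: "\<And>n. v n \<in> E.D" and u: "u \<in> L0 M" and lim: "AE x in M. (\<lambda>n. v n x) \<longlonglongrightarrow> u x"
    and bnd: "\<And>n. E'.Q (v n) \<le> c"
  shows "u \<in> E.D"
proof -
  have "E u \<le> ennreal c"
  proof (rule E.lower_semicontinuous[OF _ u lim])
    show "v n \<in> L0 M" for n by (rule E.dom_L0[OF v])
    show "E (v n) \<le> ennreal c" for n
      using ord_eq_le_trans[OF E'.q_eq_Q ennreal_leI, OF dom_subset[OF v] bnd] E'_eq_E[OF v] by simp
    show "0 \<le> c"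
      by (rule order_trans[OF enn2real_nonneg bnd])
  qed
  then show ?thesis
    using u by (auto simp: form_dom_def intro: le_less_trans)
qed

lemma dom_eqI:
  assumes "E'.D \<subseteq> E.D" "f \<in> L0 M"
  shows "E f = E' f"
proof (cases "E' f = \<infinity>")
  case True
  then have "f \<notin> E.D"
    using dom_subset[of f] by (auto simp: form_dom_def)
  then show ?thesis
    using True assms(2) by (simp add: form_dom_def less_top[symmetric])
next
  case False
  then have "f \<in> E.D"
    using assms by (auto simp: form_dom_def less_top)
  then show ?thesis
    by (simp add: E'_eq_E)
qed

section \<open>From small capacities along a special nest to equality of the domains\<close>

context
  fixes \<N>
  assumes \<N>: "special_nest M E \<N>" and cap0: "(INF N\<in>\<N>. cap M E' h (space M - N)) = 0"
begin

text \<open>Truncating at \<open>h\<close> costs no energy since \<open>h\<close> is superharmonic.\<close>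

lemma ex_small_majorant:
  "\<exists>N e. N \<in> \<N> \<and> e \<in> E'.D \<and> (\<forall>x. 0 \<le> e x \<and> e x \<le> max 0 (h x))
     \<and> (AE x in M. x \<notin> N \<longrightarrow> h x \<le> e x) \<and> E'.Q e \<le> (1 / 2) ^ n"
proof -
  have "(INF N\<in>\<N>. cap M E' h (space M - N)) < ennreal ((1 / 2) ^ n)"
    by (simp add: cap0)
  then obtain N where N: "N \<in> \<N>" and "cap M E' h (space M - N) < ennreal ((1 / 2) ^ n)"
    unfolding INF_less_iff by blast
  then obtain f where f: "f \<in> L0 M" "E' f < ennreal ((1 / 2) ^ n)"
    and ge: "AE x in M. h x * indicator (space M - N) x \<le> f x * indicator (space M - N) x"
    unfolding cap_def Inf_less_iff by blast
  have fD: "f \<in> E'.D"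
    using f by (auto simp: form_dom_def intro: less_trans)
  let ?m = "\<lambda>x. min (f x) (h x)"
  let ?e = "\<lambda>x. max 0 (?m x)"
  have m: "?m \<in> E'.D"
    by (rule E'.dom_min[OF fD h_dom])
  have "E'.Q ?e \<le> E'.Q ?m"
    by (rule E'.Q_le_of_q_le[OF m E'.q_pos_part[OF E'.dom_L0[OF m]]])
  also have "\<dots> \<le> E'.Q f"
    by (rule E'.Q_min_superharmonic[OF h fD])
  also have "\<dots> \<le> (1 / 2) ^ n"
    using f(2) by (intro enn2real_leI) simp_all
  finally have "E'.Q ?e \<le> (1 / 2) ^ n" .
  moreover have "AE x in M. x \<notin> N \<longrightarrow> h x \<le> ?e x"
    using ge AE_space by eventually_elim (auto simp: indicator_def min_def max_def split: if_splits)
  \<comment> \<open>\<open>h\<close> is positive only almost everywhere, while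
    \<open>tendsto_0_of_summable_Q\<close> asks for a bound at every point; hence max(0, h).\<close>
  moreover have "\<forall>x. 0 \<le> ?e x \<and> ?e x \<le> max 0 (h x)"
    by (auto simp: min_def max_def)
  ultimately show ?thesis
    using N E'.dom_pos_part[OF m] by blast
qed

lemma ex_exhausting_sequence:
  obtains N e where "\<And>n. N n \<in> \<N>" "\<And>n. e n \<in> E'.D" "\<And>n x. 0 \<le> e n x"
    "\<And>n. AE x in M. x \<notin> N n \<longrightarrow> h x \<le> e n x" "\<And>n. E'.Q (e n) \<le> 1"
    "AE x in M. (\<lambda>n. e n x) \<longlonglongrightarrow> 0"
proof -
  define P where "P n N e \<longleftrightarrow> N \<in> \<N> \<and> e \<in> E'.D \<and> (\<forall>x. 0 \<le> e x \<and> e x \<le> max 0 (h x))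
     \<and> (AE x in M. x \<notin> N \<longrightarrow> h x \<le> e x) \<and> E'.Q e \<le> (1 / 2) ^ n" for n N e
  have "\<forall>n. \<exists>N e. P n N e"
    unfolding P_def by (rule allI, rule ex_small_majorant)
  then obtain N e where "\<And>n. P n (N n) (e n)"
    by metis
  then have Ne: "\<And>n. N n \<in> \<N>" "\<And>n. e n \<in> E'.D" "\<And>n x. 0 \<le> e n x" "\<And>n x. e n x \<le> max 0 (h x)"
    "\<And>n. AE x in M. x \<notin> N n \<longrightarrow> h x \<le> e n x" "\<And>n. E'.Q (e n) \<le> (1 / 2) ^ n"
    unfolding P_def by blast+
  have "E'.Q (e n) \<le> 1" for n
    using order_trans[OF Ne(6), of n 1] by (simp add: power_le_one)
  moreover have "AE x in M. (\<lambda>n. e n x) \<longlonglongrightarrow> 0"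
    by (rule E'.tendsto_0_of_summable_Q[OF tr Ne(2,3,4,6)])
  ultimately show thesis
    using that Ne by blast
qed

text \<open>A function dominated by the indicator of \<open>N\<close> is its own product with the truncated cutoff
  function of \<open>N\<close>.\<close>

lemma dom_of_supported:
  assumes u: "u \<in> E'.D" and bnd: "\<And>x. \<bar>u x\<bar> \<le> 1"
    and N: "N \<in> \<N>" and supp: "AE x in M. x \<notin> N \<longrightarrow> u x = 0"
  shows "u \<in> E.D"
proof -
  obtain g where g: "g \<in> E.D" "AE x in M. indicator N x \<le> g x"
    using \<N> N unfolding special_nest_def nest_dom_def by blast
  let ?g = "\<lambda>x. max 0 (min 1 (g x))"
  have gD: "?g \<in> E.D"
    by (rule E.dom_clamp[OF g(1)]) simp
  have "?g \<in> Linfty M"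
    using E.dom_L0[OF gD] unfolding Linfty_def by (auto intro!: exI[of _ 1])
  moreover have "u \<in> Linfty M"
    using E'.dom_L0[OF u] bnd unfolding Linfty_def by (auto intro!: exI[of _ 1])
  ultimately have "(\<lambda>x. ?g x * u x) \<in> E.D"
    by (rule product_dom[OF gD _ u])
  moreover have "AE x in M. ?g x * u x = u x"
    using g(2) supp
  proof eventually_elim
    case (elim x)
    then show ?case by (cases "x \<in> N") simp_all
  qed
  ultimately show ?thesis
    using E.dom_cong E'.dom_L0[OF u] by blast
qed

lemma dom_of_bounded:
  assumes f: "f \<in> E'.D" and bnd: "\<And>x. 0 \<le> f x" "\<And>x. f x \<le> 1" and le: "AE x in M. f x \<le> h x"
  shows "f \<in> E.D"
proof -
  obtain N e where N: "\<And>n. N n \<in> \<N>" and e: "\<And>n. e n \<in> E'.D" "\<And>n x. 0 \<le> e n x"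
    "\<And>n. AE x in M. x \<notin> N n \<longrightarrow> h x \<le> e n x" "\<And>n. E'.Q (e n) \<le> 1"
    "AE x in M. (\<lambda>n. e n x) \<longlonglongrightarrow> 0"
    using ex_exhausting_sequence by blast
  let ?v = "\<lambda>n x. max 0 (f x - e n x)"
  have d: "(\<lambda>x. f x - e n x) \<in> E'.D" for n
    by (rule E'.dom_diff[OF f e(1)])
  have vD: "?v n \<in> E'.D" for n
    by (rule E'.dom_pos_part[OF d])
  show ?thesis
  proof (rule dom_of_approximation)
    show "?v n \<in> E.D" for n
    proof (rule dom_of_supported[OF vD _ N])
      show "\<bar>?v n x\<bar> \<le> 1" for x
        using bnd[of x] e(2)[of n x] by simp
      \<comment> \<open>Off \<open>N n\<close> one has f <= h <= e_n, so the difference is not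
        positive.\<close>
      show "AE x in M. x \<notin> N n \<longrightarrow> ?v n x = 0"
        using e(3)[of n] le by eventually_elim auto
    qed
    show "f \<in> L0 M" by (rule E'.dom_L0[OF f])
    show "AE x in M. (\<lambda>n. ?v n x) \<longlonglongrightarrow> f x"
      using e(5)
    proof eventually_elim
      case (elim x)
      have "(\<lambda>n. ?v n x) \<longlonglongrightarrow> max 0 (f x - 0)"
        by (intro tendsto_intros elim)
      then show ?case using bnd(1)[of x] by simp
    qed
    show "E'.Q (?v n) \<le> 2 * E'.Q f + 2" for n
    proof -
      have "E'.Q (?v n) \<le> E'.Q (\<lambda>x. f x - e n x)"
        by (rule E'.Q_le_of_q_le[OF d E'.q_pos_part[OF E'.dom_L0[OF d]]])
      then show ?thesis
        using E'.Q_parallelogram[OF f e(1)[of n]] e(4)[of n]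
          enn2real_nonneg[of "E' (\<lambda>x. f x + e n x)"] by linarith
    qed
  qed
qed

text \<open>The approximants are min(f, (n + 1) h, n + 1) almost everywhere. Writing them as
  rescaled cuts of f / (n + 1) makes \<open>dom_of_bounded\<close> applicable and keeps their energy
  below that of \<open>f\<close>.\<close>

lemma dom_of_nonneg:
  assumes f: "f \<in> E'.D" and pos: "\<And>x. 0 \<le> f x"
  shows "f \<in> E.D"
proof -
  define g where "g n = (\<lambda>x. min (inverse (real (Suc n)) * f x) (h x))" for n
  define u where "u n = (\<lambda>x. max 0 (min 1 (g n x)))" for n
  have sD: "(\<lambda>x. inverse (real (Suc n)) * f x) \<in> E'.D" for n
    by (rule E'.dom_scale[OF f])
  have gD: "g n \<in> E'.D" for n
    unfolding g_def by (rule E'.dom_min[OF sD h_dom])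
  have uD': "u n \<in> E'.D" for n
    unfolding u_def by (rule E'.dom_clamp[OF gD]) simp
  have uD: "u n \<in> E.D" for n
  proof (rule dom_of_bounded[OF uD'])
    show "AE x in M. u n x \<le> h x"
      using h_pos by eventually_elim (simp add: u_def g_def min_le_iff_disj)
  qed (simp_all add: u_def)
  show ?thesis
  proof (rule dom_of_approximation)
    show "(\<lambda>x. real (Suc n) * u n x) \<in> E.D" for n
      by (rule E.dom_scale[OF uD])
    show "f \<in> L0 M" by (rule E'.dom_L0[OF f])
    show "AE x in M. (\<lambda>n. real (Suc n) * u n x) \<longlonglongrightarrow> f x"
      using h_pos
    proof eventually_elim
      case (elim x)
      \<comment> \<open>Once f(x) / (n + 1) <= c, neither the cut at 1 nor the cut at
        \<open>h\<close> is active at \<open>x\<close>.\<close>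
      define c where "c = min 1 (h x)"
      have c: "0 < c" using elim by (simp add: c_def)
      show ?case
      proof (rule tendsto_eventually)
        show "\<forall>\<^sub>F n in sequentially. real (Suc n) * u n x = f x"
          using eventually_ge_at_top[of "nat \<lceil>f x / c\<rceil>"]
        proof eventually_elim
          case (elim n)
          then have "f x / c \<le> real (Suc n)" by linarith
          then have "f x \<le> real (Suc n) * c"
            using c by (simp add: divide_le_eq del: of_nat_Suc)
          then have "inverse (real (Suc n)) * f x \<le> c"
            by (simp add: field_simps)
          then have "inverse (real (Suc n)) * f x \<le> 1" "inverse (real (Suc n)) * f x \<le> h x"
            by (simp_all add: c_def del: of_nat_Suc)
          moreover have "0 \<le> inverse (real (Suc n)) * f x"
            using pos[of x] by (intro mult_nonneg_nonneg) auto
          ultimately have "u n x = inverse (real (Suc n)) * f x"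
            by (simp add: u_def g_def min_absorb1 min_absorb2 max_absorb2 del: of_nat_Suc)
          then show ?case by (simp del: of_nat_Suc)
        qed
      qed
    qed
    show "E'.Q (\<lambda>x. real (Suc n) * u n x) \<le> E'.Q f" for n
    proof -
      have "E'.Q (u n) \<le> E'.Q (g n)"
        unfolding u_def by (rule E'.Q_le_of_q_le[OF gD E'.q_clamp[OF E'.dom_L0[OF gD]]]) simp
      also have "\<dots> \<le> E'.Q (\<lambda>x. inverse (real (Suc n)) * f x)"
        unfolding g_def by (rule E'.Q_min_superharmonic[OF h sD])
      finally have "(real (Suc n))\<^sup>2 * E'.Q (u n) \<le> (real (Suc n))\<^sup>2 * ((inverse (real (Suc n)))\<^sup>2 * E'.Q f)"
        unfolding E'.Q_scale[OF f] by (intro mult_left_mono) auto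
      also have "\<dots> = E'.Q f"
        by (simp add: power_inverse del: of_nat_Suc)
      finally show ?thesis
        unfolding E'.Q_scale[OF uD'] .
    qed
  qed
qed

lemma dom_eq: "E'.D \<subseteq> E.D"
proof
  fix f assume f: "f \<in> E'.D"
  have mf: "(\<lambda>x. - f x) \<in> E'.D"
    using E'.dom_scale[OF f, of "- 1"] by simp
  have "(\<lambda>x. max 0 (f x) - max 0 (- f x)) \<in> E.D"
    by (intro E.dom_diff dom_of_nonneg E'.dom_pos_part f mf) auto
  moreover have "(\<lambda>x. max 0 (f x) - max 0 (- f x)) = f"
    by (auto simp: max_def)
  ultimately show "f \<in> E.D"
    by simp
qed

end

end

theorem theorem3p24:
  fixes M :: "'a measure"
    and E E' :: "('a \<Rightarrow> real) \<Rightarrow> ennreal"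
    and h :: "'a \<Rightarrow> real"
  assumes "localizable M"
    and "energy_form M E"
    and "silverstein_extension M E E'"
    and "transient M E'"
    and "superharmonic M E' h"
    and "AE x in M. 0 < h x"
  shows "((\<exists>\<N>. special_nest M E \<N> \<and> (INF N\<in>\<N>. cap M E' h (space M - N)) = 0)
            \<longleftrightarrow> (\<forall>\<N>. nest M E \<N> \<longrightarrow> (INF N\<in>\<N>. cap M E' h (space M - N)) = 0))
       \<and> ((\<forall>\<N>. nest M E \<N> \<longrightarrow> (INF N\<in>\<N>. cap M E' h (space M - N)) = 0)
            \<longleftrightarrow> (\<forall>f\<in>L0 M. E f = E' f))"
    (is "(?i \<longleftrightarrow> ?ii) \<and> (_ \<longleftrightarrow> ?iii)")
proof -
  interpret transient_silverstein_extension M E E' h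
    by standard (use assms in \<open>auto simp: localizable_def\<close>)
  have "?ii \<Longrightarrow> ?i"
    using E.special_level_nest unfolding special_nest_def by blast
  moreover have "?i \<Longrightarrow> ?iii"
    using dom_eqI[OF dom_eq] by blast
  moreover have "?iii \<Longrightarrow> ?ii"
  proof (intro allI impI)
    fix \<N> assume eq: ?iii and nest: "nest M E \<N>"
    \<comment> \<open>Equality of the forms puts \<open>h\<close> into D(E), where the functions of
      an E-nest are dense.\<close>
    then have "h \<in> E.D"
      using h_dom by (simp add: form_dom_def)
    with nest have "(INF N\<in>\<N>. cap M E h (space M - N)) = 0"
      by (rule cap_nest_eq_0[OF E.qf])
    then show "(INF N\<in>\<N>. cap M E' h (space M - N)) = 0"
      using cap_cong[of M E E'] eq by simp
  qed
  ultimately show ?thesis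
    by blast
qed

end
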